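(* In the setting described in the context (problem $\min F=f+r$, stochastic models satisfying (C1)–(C5) with $\mu>0$), suppose that $\eta_t = \frac{1}{\mu(t+1)}$ for all $t \geq 0$. Then for all integers $T > 0$, the iterates of the stochastic model-based algorithm satisfy $$\mathbb{E}\left[F\left(\frac{1}{T+1}\sum_{t=0}^T x_t\right) - F(x^\ast) + \mu D_\Phi (x^\ast, x_{T+1})\right] \leq \frac{ \frac{\mathsf{L}^2(1 + \log(T+1))}{4\mu} + r(x_0) - \inf r + \mu D_{\Phi}(x^\ast, x_0)}{T+1},$$ where $x^*$ is any minimizer of $F$.
   Context: Legendre functions. $\Phi\colon\mathbb{R}^d\to\mathbb{R}\cup\{\infty\}$ is a Legendre function: it is proper, closed, strictly convex; $U:=\mathrm{int}(\mathrm{dom}\,\Phi)$ is nonempty; $\Phi$ is differentiable on $U$; and $\|\nabla\Phi(x_k)\|\to\infty$ for any sequence $\{x_k\}\subset U$ converging to a boundary point of $\mathrm{dom}\,\Phi$. Its Bregman divergence is $D_\Phi(y,x)=\Phi(y)-\Phi(x)-\langle\nabla\Phi(x),y-x\rangle$ for $x\in U$ (equal to $+\infty$ if $y\notin\mathrm{dom}\,\Phi$). A function $g$ is $\mu$-strongly convex relative to $\Phi$ if $g-\mu\Phi$ is convex (for functions defined only on $U$: convex on $U$). Problem. $\min_x F(x):=f(x)+r(x)$, where $f\colon\mathbb{R}^d\to\mathbb{R}$ is locally Lipschitz, $r\colon\mathbb{R}^d\to\mathbb{R}\cup\{\infty\}$ is closed with convex domain, and $\mathrm{ri}(\mathrm{dom}\,r)\subseteq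 U$ and $\partial(r+\Phi)(x)=\emptyset$ for all $x\notin U$. Here $\partial$ is the limiting subdifferential: $v\in\partial g(x)$ iff there are $x_k\to x$ with $g(x_k)\to g(x)$ and $v_k\to v$ with $v_k\in\hat\partial g(x_k)$, where $\hat\partial g(x)=\{v: g(y)\ge g(x)+\langle v,y-x\rangle+o(\|y-x\|)\text{ as }y\to x\}$. Assumptions. $(\Omega,\mathcal{F},P)$ is a probability space and: (C1) i.i.d. samples $\xi_0,\xi_1,\ldots\sim P$ can be generated. (C2) There is a measurable function $(x,y,\xi)\mapsto f_x(y,\xi)$ on $U\times U\times\Omega$ with $\mathbb{E}_\xi[f_x(x,\xi)]=f(x)$ for all $x\in U\cap\mathrm{dom}\,r$ and $\mathbb{E}_\xi[f_x(y,\xi)]\le f(y)$ for all $x,y\in U\cap\mathrm{dom}\,r$. (C3) $f_x(\cdot,\xi)+r(\cdot)$ is $\mu$-strongly convex relative to $\Phi$ for all $x\in U\cap\mathrm{dom}\,r$ and a.e. $\xi\in\Omega$; here $\mu>0$. (C4) There are $\mathsf{L}>0$ and a square integrable $L\colon\Omega\to\mathbb{R}_+$ with $\sqrt{\mathbb{E}_\xi[L(\xi)^2]}\le\mathsf{L}$ and $f_x(x,\xi)-f_x(y,\xi)\le L(\xi)\sqrt{D_\Phi(y,x)}$ for all $x,y\in U\cap\mathrm{dom}\,r$. (C5) For every $\lambda>0$, $x\in U$ and a.e. $\xi$, the problems $\min_y\{F(y)+\frac1\lambda D_\Phi(y,x)\}$ and $\min_y\{f_x(y,\xi)+r(y)+\frac1\lambda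 D_\Phi(y,x)\}$ admit minimizers (unique and lying in $U$), varying measurably in $(x,\xi)\in U\times\Omega$. Minimization involving the models is over $y\in U$. Algorithm. Given $x_0\in U\cap\mathrm{dom}\,r$ and a nonincreasing sequence of step-sizes $\eta_t>0$: for $t=0,1,2,\ldots$, sample $\xi_t\sim P$ (independently) and set $x_{t+1}=\mathrm{argmin}_x\{f_{x_t}(x,\xi_t)+r(x)+\frac{1}{\eta_t}D_\Phi(x,x_t)\}$. *)

theory Defs
  imports "HOL-Probability.Probability" "HOL-Library.Landau_Symbols"
begin

text \<open>Functions \<open>\<real>\<^sup>d \<rightarrow> \<real> \<union> {\<infinity>}\<close> are maps into \<open>ereal\<close> that never take the value \<open>-\<infinity>\<close>.\<close>

definition edom :: "('a \<Rightarrow> ereal) \<Rightarrow> 'a set" where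
  "edom g = {x. g x < \<infinity>}"

definition closed_fun :: "('a::topological_space \<Rightarrow> ereal) \<Rightarrow> bool" where
  "closed_fun g \<longleftrightarrow> closed {(x, t::real). g x \<le> ereal t}"

definition convex_efun_on :: "'a::real_vector set \<Rightarrow> ('a \<Rightarrow> ereal) \<Rightarrow> bool" where
  "convex_efun_on S g \<longleftrightarrow> convex S \<and>
     (\<forall>x\<in>S. \<forall>y\<in>S. \<forall>u\<ge>0. \<forall>v\<ge>0. u + v = 1 \<longrightarrow>
        g (u *\<^sub>R x + v *\<^sub>R y) \<le> ereal u * g x + ereal v * g y)"

definition strictly_convex_efun :: "('a::real_vector \<Rightarrow> ereal) \<Rightarrow> bool" where
  "strictly_convex_efun g \<longleftrightarrow>
     (\<forall>x\<in>edom g. \<forall>y\<in>edom g. \<forall>u>0. \<forall>v>0. x \<noteq> y \<longrightarrow> u + v = 1 \<longrightarrow>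
        g (u *\<^sub>R x + v *\<^sub>R y) < ereal u * g x + ereal v * g y)"

text \<open>The gradient of the real-valued restriction of \<open>g\<close>; meaningful only at points of the interior
  of the domain at which \<open>g\<close> is differentiable.\<close>

definition egrad :: "('a::euclidean_space \<Rightarrow> ereal) \<Rightarrow> 'a \<Rightarrow> 'a" where
  "egrad g x = (THE v. GDERIV (\<lambda>y. real_of_ereal (g y)) x :> v)"

definition legendre :: "('a::euclidean_space \<Rightarrow> ereal) \<Rightarrow> bool" where
  "legendre \<Phi> \<longleftrightarrow>
     (\<forall>x. \<Phi> x \<noteq> -\<infinity>) \<and> edom \<Phi> \<noteq> {} \<and> closed_fun \<Phi> \<and> strictly_convex_efun \<Phi> \<and>
     interior (edom \<Phi>) \<noteq> {} \<and>
     (\<forall>x\<in>interior (edom \<Phi>). (\<lambda>y. real_of_ereal (\<Phi> y)) differentiable (at x)) \<and>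
     (\<forall>X x. (\<forall>k. X k \<in> interior (edom \<Phi>)) \<and> X \<longlonglongrightarrow> x \<and> x \<in> frontier (edom \<Phi>) \<longrightarrow>
        filterlim (\<lambda>k::nat. norm (egrad \<Phi> (X k))) at_top sequentially)"

text \<open>To be used with \<open>x\<close> in the interior of the domain; since \<open>\<Phi> x\<close> is then finite, the value is
  \<open>\<infinity>\<close> whenever \<open>y\<close> lies outside the domain.\<close>

definition bregman :: "('a::euclidean_space \<Rightarrow> ereal) \<Rightarrow> 'a \<Rightarrow> 'a \<Rightarrow> ereal" where
  "bregman \<Phi> y x = \<Phi> y - \<Phi> x - ereal (egrad \<Phi> x \<bullet> (y - x))"

definition rel_strongly_convex_on ::
    "'a::real_vector set \<Rightarrow> real \<Rightarrow> ('a \<Rightarrow> ereal) \<Rightarrow> ('a \<Rightarrow> ereal) \<Rightarrow> bool" where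
  "rel_strongly_convex_on S \<mu> \<Phi> g \<longleftrightarrow> convex_efun_on S (\<lambda>x. g x - ereal \<mu> * \<Phi> x)"

text \<open>Both subdifferentials are empty, by the usual convention, at points where \<open>g\<close> is infinite.\<close>

definition frechet_subdiff :: "('a::euclidean_space \<Rightarrow> ereal) \<Rightarrow> 'a \<Rightarrow> 'a set" where
  "frechet_subdiff g x = {v. \<bar>g x\<bar> \<noteq> \<infinity> \<and>
     (\<exists>h\<in>o[at x](\<lambda>y. norm (y - x)).
        \<forall>\<^sub>F y in at x. g y \<ge> g x + ereal (v \<bullet> (y - x)) + ereal (h y))}"

definition limiting_subdiff :: "('a::euclidean_space \<Rightarrow> ereal) \<Rightarrow> 'a \<Rightarrow> 'a set" where
  "limiting_subdiff g x = {v. \<bar>g x\<bar> \<noteq> \<infinity> \<and>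
     (\<exists>(X::nat \<Rightarrow> 'a) V. X \<longlonglongrightarrow> x \<and> (\<lambda>k. g (X k)) \<longlonglongrightarrow> g x \<and> V \<longlonglongrightarrow> v \<and>
        (\<forall>k. V k \<in> frechet_subdiff g (X k)))}"

definition locally_lipschitz :: "('a::metric_space \<Rightarrow> real) \<Rightarrow> bool" where
  "locally_lipschitz f \<longleftrightarrow> (\<forall>x. \<exists>e>0. \<exists>K. K-lipschitz_on (ball x e) f)"

definition unique_minimizer_on :: "'a set \<Rightarrow> ('a \<Rightarrow> ereal) \<Rightarrow> 'a \<Rightarrow> bool" where
  "unique_minimizer_on S g x \<longleftrightarrow> (\<forall>z. is_arg_min g (\<lambda>y. y \<in> S) z \<longleftrightarrow> z = x)"

text \<open>Expectation of an extended-real random variable as the difference of the expectations of its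
  positive and negative parts (\<open>e2ennreal\<close> sends negative numbers to \<open>0\<close>). The undefined case
  \<open>\<infinity> - \<infinity>\<close> evaluates to \<open>\<infinity>\<close>, so a finite upper bound rules it out.\<close>

definition ereal_expectation :: "'w measure \<Rightarrow> ('w \<Rightarrow> ereal) \<Rightarrow> ereal" where
  "ereal_expectation M X =
     enn2ereal (\<integral>\<^sup>+\<omega>. e2ennreal (X \<omega>) \<partial>M) - enn2ereal (\<integral>\<^sup>+\<omega>. e2ennreal (- X \<omega>) \<partial>M)"

text \<open>Minimization problem \<open>min f + r\<close> with geometry \<open>\<Phi>\<close>.\<close>

definition composite_problem ::
    "('a::euclidean_space \<Rightarrow> ereal) \<Rightarrow> ('a \<Rightarrow> real) \<Rightarrow> ('a \<Rightarrow> ereal) \<Rightarrow> bool" where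
  "composite_problem \<Phi> f r \<longleftrightarrow>
     locally_lipschitz f \<and>
     (\<forall>x. r x \<noteq> -\<infinity>) \<and> closed_fun r \<and> convex (edom r) \<and>
     rel_interior (edom r) \<subseteq> interior (edom \<Phi>) \<and>
     (\<forall>x. x \<notin> interior (edom \<Phi>) \<longrightarrow> limiting_subdiff (\<lambda>y. r y + \<Phi> y) x = {})"

text \<open>The models are given by \<open>m x y \<xi> = f\<^sub>x(y, \<xi>)\<close>, with \<open>x\<close> the base point; only the values for
  \<open>x\<close> and \<open>y\<close> in the interior of the domain of \<open>\<Phi>\<close> matter.\<close>

definition unbiased_lower_model ::
    "('a::euclidean_space \<Rightarrow> ereal) \<Rightarrow> ('a \<Rightarrow> real) \<Rightarrow> ('a \<Rightarrow> ereal) \<Rightarrow> 'w measure \<Rightarrow>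
     ('a \<Rightarrow> 'a \<Rightarrow> 'w \<Rightarrow> real) \<Rightarrow> bool" where
  "unbiased_lower_model \<Phi> f r P m \<longleftrightarrow>
     (let U = interior (edom \<Phi>) in
       (\<lambda>(x, y, \<xi>). m x y \<xi>) \<in>
         borel_measurable (restrict_space borel U \<Otimes>\<^sub>M restrict_space borel U \<Otimes>\<^sub>M P) \<and>
       (\<forall>x\<in>U \<inter> edom r. (\<integral>\<xi>. m x x \<xi> \<partial>P) = f x) \<and>
       (\<forall>x\<in>U \<inter> edom r. \<forall>y\<in>U \<inter> edom r.
          integrable P (m x y) \<and> (\<integral>\<xi>. m x y \<xi> \<partial>P) \<le> f y))"

definition rel_strongly_convex_model ::
    "('a::euclidean_space \<Rightarrow> ereal) \<Rightarrow> ('a \<Rightarrow> ereal) \<Rightarrow> 'w measure \<Rightarrow>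
     ('a \<Rightarrow> 'a \<Rightarrow> 'w \<Rightarrow> real) \<Rightarrow> real \<Rightarrow> bool" where
  "rel_strongly_convex_model \<Phi> r P m \<mu> \<longleftrightarrow>
     (let U = interior (edom \<Phi>) in
       \<forall>x\<in>U \<inter> edom r. AE \<xi> in P.
         rel_strongly_convex_on U \<mu> \<Phi> (\<lambda>y. ereal (m x y \<xi>) + r y))"

definition rel_lipschitz_model ::
    "('a::euclidean_space \<Rightarrow> ereal) \<Rightarrow> ('a \<Rightarrow> ereal) \<Rightarrow> 'w measure \<Rightarrow>
     ('a \<Rightarrow> 'a \<Rightarrow> 'w \<Rightarrow> real) \<Rightarrow> ('w \<Rightarrow> real) \<Rightarrow> real \<Rightarrow> bool" where
  "rel_lipschitz_model \<Phi> r P m L Lbar \<longleftrightarrow>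
     (let U = interior (edom \<Phi>) in
       Lbar > 0 \<and> L \<in> borel_measurable P \<and> (\<forall>\<xi>\<in>space P. L \<xi> \<ge> 0) \<and>
       integrable P (\<lambda>\<xi>. (L \<xi>)\<^sup>2) \<and> sqrt (\<integral>\<xi>. (L \<xi>)\<^sup>2 \<partial>P) \<le> Lbar \<and>
       (\<forall>x\<in>U \<inter> edom r. AE \<xi> in P. \<forall>y\<in>U \<inter> edom r.
          m x x \<xi> - m x y \<xi> \<le> L \<xi> * sqrt (real_of_ereal (bregman \<Phi> y x))))"

text \<open>Here \<open>S \<alpha> (x, \<xi>)\<close> is a measurable version of the argmin of the model subproblem with proximal
  parameter \<open>\<alpha>\<close>: it is the unique minimizer for every \<open>x\<close> and almost every \<open>\<xi>\<close>.\<close>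

definition solvable_subproblems ::
    "('a::euclidean_space \<Rightarrow> ereal) \<Rightarrow> ('a \<Rightarrow> real) \<Rightarrow> ('a \<Rightarrow> ereal) \<Rightarrow> 'w measure \<Rightarrow>
     ('a \<Rightarrow> 'a \<Rightarrow> 'w \<Rightarrow> real) \<Rightarrow> (real \<Rightarrow> 'a \<times> 'w \<Rightarrow> 'a) \<Rightarrow> bool" where
  "solvable_subproblems \<Phi> f r P m S \<longleftrightarrow>
     (let U = interior (edom \<Phi>) in
       \<forall>\<alpha>>0.
         (\<exists>p \<in> restrict_space borel U \<rightarrow>\<^sub>M restrict_space borel U. \<forall>x\<in>U.
            unique_minimizer_on UNIV
              (\<lambda>y. ereal (f y) + r y + ereal (1 / \<alpha>) * bregman \<Phi> y x) (p x)) \<and>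
         S \<alpha> \<in> restrict_space borel U \<Otimes>\<^sub>M P \<rightarrow>\<^sub>M restrict_space borel U \<and>
         (\<forall>x\<in>U. AE \<xi> in P.
            unique_minimizer_on U
              (\<lambda>y. ereal (m x y \<xi>) + r y + ereal (1 / \<alpha>) * bregman \<Phi> y x) (S \<alpha> (x, \<xi>))))"

end

theory Submission
  imports Defs
begin

text \<open>
  The bound comes from a Lyapunov argument. Fix a comparison point \<open>y\<close> in \<open>U = interior (edom \<Phi>)\<close>
  with \<open>r y\<close> finite. Because the model (with \<open>r\<close> included) minus \<open>\<mu> \<Phi>\<close> is convex, the minimizer
  \<open>p\<close> of the model plus
  \<open>\<alpha> D(\<cdot>, a)\<close>, where \<open>a\<close> is the current iterate, beats \<open>y\<close> by at
  least \<open>(\<alpha> + \<mu>) D(y, p)\<close> (\<open>bregman_three_point\<close>). The relative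
  Lipschitz bound allows the model value at \<open>p\<close> to be replaced by that at \<open>a\<close>, at the price
  \<open>L sqrt (D(p, a)) - \<alpha> D(p, a) \<le> L\<^sup>2 / (4 \<alpha>)\<close>. Taking expectations over the sample
  turns model values into values of \<open>f\<close>, which gives \<open>stochastic_step\<close>:
  the potential \<open>(r - \<rho>) + \<alpha> D(y, \<cdot>)\<close>, with \<open>\<rho> = inf r\<close>, decreases in expectation by the gap
  \<open>F a - F xstar\<close>, up to an error, while the weight of the divergence grows from \<open>\<alpha>\<close> to
  \<open>\<alpha> + \<mu>\<close>. With \<open>\<alpha> = 1 / \<eta> t = \<mu> (t + 1)\<close> the new weight is exactly the one required at the next
  step, so the inequalities telescope (\<open>expected_gap_telescope\<close>), and the errors
  \<open>Lbar\<^sup>2 / (4 \<mu> (t + 1))\<close> add up to the logarithm. Finally, \<open>F\<close> is convex on \<open>U\<close>, being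
  supported at each point by the expected model (\<open>objective_convex\<close>), and Jensen's inequality passes to
  the averaged iterate.

  Every quantity in the telescoped inequality is nonnegative, since only the gap \<open>F - F xstar\<close>, the excess
  \<open>r - \<rho>\<close> and the divergence occur. The argument can therefore be carried out
  with nonnegative integrals. This matters because quantities such as \<open>m (x t) (x t) (\<xi> t)\<close>
  need not be integrable along the iterates: the hypotheses bound the expectation of a model only for each fixed
  base point, not uniformly over base points.

  If \<open>\<Phi> xstar\<close> or \<open>- \<rho>\<close> is infinite, so is the bound. Otherwise \<open>xstar\<close> may still lie on the boundary
  of \<open>U\<close>, where the models give no information.
  It is reached as a limit of admissible comparison points \<open>y\<close> along which both \<open>r\<close> and \<open>\<Phi>\<close> converge.
  Such points exist because subdifferentiability of \<open>r + \<Phi>\<close> is dense in the graph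
  (\<open>dense_subdifferentiability\<close>), whereas by assumption \<open>r + \<Phi>\<close> has no subgradients outside \<open>U\<close>.
  Fatou's lemma then transfers the inequality to \<open>xstar\<close>.
\<close>

section \<open>Legendre functions and Bregman divergences\<close>

abbreviation real_bregman :: "('a::euclidean_space \<Rightarrow> ereal) \<Rightarrow> 'a \<Rightarrow> 'a \<Rightarrow> real" where
  "real_bregman \<Phi> y x \<equiv> real_of_ereal (bregman \<Phi> y x)"

lemma ereal_real_edom:
  assumes "g x \<noteq> -\<infinity>" "x \<in> edom g"
  shows "g x = ereal (real_of_ereal (g x))"
  using assms by (cases "g x") (auto simp: edom_def)

lemma convex_edom_legendre:
  assumes "legendre \<Phi>"
  shows "convex (edom \<Phi>)"
proof (rule convexI)
  fix y z :: 'a and u v :: real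
  assume y: "y \<in> edom \<Phi>" and z: "z \<in> edom \<Phi>" and uv: "0 \<le> u" "0 \<le> v" "u + v = 1"
  show "u *\<^sub>R y + v *\<^sub>R z \<in> edom \<Phi>"
  proof (cases "y = z \<or> u = 0 \<or> v = 0")
    case True
    then show ?thesis
      using y z uv by (auto simp flip: scaleR_left_distrib)
  next
    case False
    then have "\<Phi> (u *\<^sub>R y + v *\<^sub>R z) < ereal u * \<Phi> y + ereal v * \<Phi> z"
      using assms y z uv unfolding legendre_def strictly_convex_efun_def by simp
    then show ?thesis
      by (auto simp: edom_def)
  qed
qed

lemma convex_on_legendre:
  assumes "legendre \<Phi>"
  shows "convex_on (edom \<Phi>) (\<lambda>y. real_of_ereal (\<Phi> y))"
proof (rule convex_onI)
  show "convex (edom \<Phi>)"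
    by (rule convex_edom_legendre[OF assms])
next
  fix t :: real and y z :: 'a
  assume t: "0 < t" "t < 1" and yz: "y \<in> edom \<Phi>" "z \<in> edom \<Phi>"
  let ?w = "(1 - t) *\<^sub>R y + t *\<^sub>R z"
  have fin: "\<Phi> p = ereal (real_of_ereal (\<Phi> p))" if "p \<in> edom \<Phi>" for p
    using assms that by (intro ereal_real_edom) (auto simp: legendre_def)
  have w: "?w \<in> edom \<Phi>"
    using convexD_alt[OF convex_edom_legendre[OF assms] yz] t by simp
  show "real_of_ereal (\<Phi> ?w) \<le> (1 - t) * real_of_ereal (\<Phi> y) + t * real_of_ereal (\<Phi> z)"
  proof (cases "y = z")
    case True
    then show ?thesis
      by (simp add: algebra_simps flip: scaleR_left_distrib)
  next
    case False
    then have "\<Phi> ?w < ereal (1 - t) * \<Phi> y + ereal t * \<Phi> z"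
      using assms yz t unfolding legendre_def strictly_convex_efun_def by simp
    then have "ereal (real_of_ereal (\<Phi> ?w))
        < ereal ((1 - t) * real_of_ereal (\<Phi> y) + t * real_of_ereal (\<Phi> z))"
      using fin[OF w] fin[OF yz(1)] fin[OF yz(2)]
      by (metis plus_ereal.simps(1) times_ereal.simps(1))
    then show ?thesis
      by simp
  qed
qed

text \<open>The gradient is a definite description, so its defining property has to be recovered from the
  existence of a derivative, which the inner product represents by a vector, and from the uniqueness of
  derivatives.\<close>

lemma has_derivative_egrad:
  assumes "legendre \<Phi>" "x \<in> interior (edom \<Phi>)"
  shows "((\<lambda>y. real_of_ereal (\<Phi> y)) has_derivative (\<lambda>h. h \<bullet> egrad \<Phi> x)) (at x)"
proof -
  let ?\<phi> = "\<lambda>y. real_of_ereal (\<Phi> y)"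
  have "?\<phi> differentiable (at x)"
    using assms unfolding legendre_def by simp
  then obtain D where D: "(?\<phi> has_derivative D) (at x)"
    unfolding differentiable_def by blast
  interpret bounded_linear D
    by (rule has_derivative_bounded_linear[OF D])
  define v where "v = (\<Sum>b\<in>Basis. D b *\<^sub>R b)"
  have "D h = h \<bullet> v" for h
  proof -
    have "D h = D (\<Sum>b\<in>Basis. (h \<bullet> b) *\<^sub>R b)"
      unfolding euclidean_representation ..
    also have "\<dots> = (\<Sum>b\<in>Basis. (h \<bullet> b) * D b)"
      by (simp add: sum scaleR)
    also have "\<dots> = h \<bullet> v"
      by (simp add: v_def inner_sum_right mult.commute)
    finally show ?thesis .
  qed
  then have "GDERIV ?\<phi> x :> v"
    using D unfolding gderiv_def by presburger
  moreover have "w = v" if "GDERIV ?\<phi> x :> w" for w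
  proof -
    have "(\<lambda>h. h \<bullet> w) = (\<lambda>h. h \<bullet> v)"
      using that \<open>GDERIV ?\<phi> x :> v\<close> unfolding gderiv_def by (rule has_derivative_unique)
    then show ?thesis
      by (metis vector_eq_ldot)
  qed
  ultimately have "egrad \<Phi> x = v"
    unfolding egrad_def by (rule the_equality)
  then show ?thesis
    using \<open>GDERIV ?\<phi> x :> v\<close> unfolding gderiv_def by simp
qed

lemma directional_derivative_egrad:
  assumes "legendre \<Phi>" "x \<in> interior (edom \<Phi>)"
  shows "((\<lambda>s. (real_of_ereal (\<Phi> (x + s *\<^sub>R d)) - real_of_ereal (\<Phi> x)) / s)
            \<longlongrightarrow> egrad \<Phi> x \<bullet> d) (at_right 0)"
proof -
  let ?\<phi> = "\<lambda>y. real_of_ereal (\<Phi> y)"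
  have "((\<lambda>s. x + s *\<^sub>R d) has_derivative (\<lambda>s. s *\<^sub>R d)) (at 0)"
    by (auto intro!: derivative_eq_intros)
  moreover have "(?\<phi> has_derivative (\<lambda>h. h \<bullet> egrad \<Phi> x)) (at (x + 0 *\<^sub>R d))"
    using has_derivative_egrad[OF assms] by simp
  ultimately have "((\<lambda>s. ?\<phi> (x + s *\<^sub>R d)) has_derivative (\<lambda>s. (s *\<^sub>R d) \<bullet> egrad \<Phi> x)) (at 0)"
    by (rule has_derivative_compose)
  moreover have "(\<lambda>s. (s *\<^sub>R d) \<bullet> egrad \<Phi> x) = (*) (egrad \<Phi> x \<bullet> d)"
    by (simp add: fun_eq_iff inner_commute)
  ultimately have "((\<lambda>s. ?\<phi> (x + s *\<^sub>R d)) has_field_derivative egrad \<Phi> x \<bullet> d) (at 0)"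
    unfolding has_field_derivative_def by simp
  then have "((\<lambda>s. (?\<phi> (x + s *\<^sub>R d) - ?\<phi> x) / s) \<longlongrightarrow> egrad \<Phi> x \<bullet> d) (at 0)"
    unfolding has_field_derivative_iff by simp
  then show ?thesis
    by (rule filterlim_mono) (auto simp: at_le)
qed

lemma bregman_eq_real:
  assumes "legendre \<Phi>" "x \<in> interior (edom \<Phi>)" "y \<in> edom \<Phi>"
  shows "bregman \<Phi> y x =
      ereal (real_of_ereal (\<Phi> y) - real_of_ereal (\<Phi> x) - egrad \<Phi> x \<bullet> (y - x))"
proof -
  have "\<Phi> p = ereal (real_of_ereal (\<Phi> p))" if "p \<in> edom \<Phi>" for p
    using assms that by (intro ereal_real_edom) (auto simp: legendre_def)
  then have "\<Phi> x = ereal (real_of_ereal (\<Phi> x))" "\<Phi> y = ereal (real_of_ereal (\<Phi> y))"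
    using assms interior_subset by blast+
  then show ?thesis
    unfolding bregman_def by (metis ereal_minus(1))
qed

text \<open>Along the segment from \<open>x\<close> to \<open>y\<close> convexity bounds the difference quotients at \<open>x\<close> by
  the full increment, hence also their limit, the directional derivative.\<close>

lemma real_bregman_nonneg:
  assumes "legendre \<Phi>" "x \<in> interior (edom \<Phi>)" "y \<in> edom \<Phi>"
  shows "0 \<le> real_bregman \<Phi> y x"
proof -
  let ?\<phi> = "\<lambda>y. real_of_ereal (\<Phi> y)"
  have xd: "x \<in> edom \<Phi>"
    using assms interior_subset by blast
  have "\<forall>\<^sub>F s in at_right (0::real). (?\<phi> (x + s *\<^sub>R (y - x)) - ?\<phi> x) / s \<le> ?\<phi> y - ?\<phi> x"
    unfolding eventually_at_right_field
  proof (intro exI[of _ 1] conjI allI impI)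
    fix s :: real assume s: "0 < s" "s < 1"
    have "?\<phi> ((1 - s) *\<^sub>R x + s *\<^sub>R y) \<le> (1 - s) * ?\<phi> x + s * ?\<phi> y"
      using convex_onD[OF convex_on_legendre[OF assms(1)]] s xd assms(3) by simp
    then have "?\<phi> (x + s *\<^sub>R (y - x)) - ?\<phi> x \<le> s * (?\<phi> y - ?\<phi> x)"
      by (simp add: algebra_simps)
    then show "(?\<phi> (x + s *\<^sub>R (y - x)) - ?\<phi> x) / s \<le> ?\<phi> y - ?\<phi> x"
      using s by (simp add: field_simps)
  qed simp
  then have "egrad \<Phi> x \<bullet> (y - x) \<le> ?\<phi> y - ?\<phi> x"
    by (rule tendsto_upperbound[OF directional_derivative_egrad[OF assms(1,2)]]) simp
  then show ?thesis
    unfolding bregman_eq_real[OF assms] by simp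
qed

text \<open>The gradient term is a limit of difference quotients along the segment from \<open>x\<close> to \<open>y\<close>. The segment stays in
  the convex set \<open>U\<close>, on which \<open>\<Phi>\<close> is continuous, so each quotient is continuous in \<open>x\<close>.\<close>

lemma borel_measurable_real_bregman:
  assumes "legendre \<Phi>" "y \<in> interior (edom \<Phi>)"
  shows "real_bregman \<Phi> y \<in> borel_measurable (restrict_space borel (interior (edom \<Phi>)))"
proof -
  let ?U = "interior (edom \<Phi>)"
  let ?\<phi> = "\<lambda>y. real_of_ereal (\<Phi> y)"
  define q where "q n x = ?\<phi> y - ?\<phi> x
      - (?\<phi> (x + inverse (real (Suc n)) *\<^sub>R (y - x)) - ?\<phi> x) / inverse (real (Suc n))" for n x
  have cont: "continuous_on ?U ?\<phi>"
    using has_derivative_egrad[OF assms(1)] has_derivative_continuous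
    by (blast intro: continuous_at_imp_continuous_on)
  have inU: "x + inverse (real (Suc n)) *\<^sub>R (y - x) \<in> ?U" if "x \<in> ?U" for x n
  proof -
    have "(1 - inverse (real (Suc n))) *\<^sub>R x + inverse (real (Suc n)) *\<^sub>R y \<in> ?U"
      by (rule convexD_alt[OF convex_interior[OF convex_edom_legendre[OF assms(1)]] that assms(2)])
         (auto simp: field_simps)
    then show ?thesis
      by (simp add: algebra_simps)
  qed
  have "q n \<in> borel_measurable (restrict_space borel ?U)" for n
    unfolding q_def
    by (intro borel_measurable_continuous_on_restrict continuous_intros cont
        continuous_on_compose2[OF cont]) (use inU in auto)
  moreover have "(\<lambda>n. q n x) \<longlonglongrightarrow> real_bregman \<Phi> y x" if "x \<in> space (restrict_space borel ?U)" for x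
  proof -
    have x: "x \<in> ?U"
      using that by simp
    have "filterlim (\<lambda>n. inverse (real (Suc n))) (at_right 0) sequentially"
      using LIMSEQ_inverse_real_of_nat by (simp add: filterlim_at_right_to_top filterlim_at del: of_nat_Suc)
    then have "(\<lambda>n. (?\<phi> (x + inverse (real (Suc n)) *\<^sub>R (y - x)) - ?\<phi> x) / inverse (real (Suc n)))
        \<longlonglongrightarrow> egrad \<Phi> x \<bullet> (y - x)"
      by (rule filterlim_compose[OF directional_derivative_egrad[OF assms(1) x]])
    then have "(\<lambda>n. q n x) \<longlonglongrightarrow> ?\<phi> y - ?\<phi> x - egrad \<Phi> x \<bullet> (y - x)"
      unfolding q_def by (intro tendsto_intros)
    then show ?thesis
      using bregman_eq_real[OF assms(1) x, of y] assms(2) interior_subset[of "edom \<Phi>"]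
      by (simp add: subset_iff)
  qed
  ultimately show ?thesis
    by (rule borel_measurable_LIMSEQ_real[rotated])
qed

section \<open>Closed functions and limiting subdifferentials\<close>

lemma closed_fun_sublevel:
  assumes "closed_fun g"
  shows "closed {x. g x \<le> ereal t}"
proof -
  have "closed ((\<lambda>x. (x, t)) -` {(x, t::real). g x \<le> ereal t})"
    using assms unfolding closed_fun_def by (intro closed_vimage continuous_intros)
  then show ?thesis
    by (simp add: vimage_def)
qed

text \<open>Sublevel sets are slices of the closed epigraph, so the set where \<open>g\<close> exceeds a level is open.\<close>

lemma closed_fun_eventually_less:
  assumes "closed_fun g" "X \<longlonglongrightarrow> x" "c < g x"
  shows "\<forall>\<^sub>F n in sequentially. c < g (X n)"
proof -
  obtain t where t: "c < ereal t" "ereal t < g x"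
    using ereal_dense2[OF assms(3)] by blast
  have "open (- {y. g y \<le> ereal t})"
    using closed_fun_sublevel[OF assms(1)] by (simp add: open_Compl)
  then have "\<forall>\<^sub>F n in sequentially. X n \<in> - {y. g y \<le> ereal t}"
    using t by (intro topological_tendstoD[OF assms(2)]) auto
  then show ?thesis
    by eventually_elim (use t in auto)
qed

lemma borel_measurable_closed_fun:
  assumes "closed_fun (g :: 'a::topological_space \<Rightarrow> ereal)"
  shows "g \<in> borel_measurable borel"
  unfolding borel_measurable_iff_Iic_ereal
proof
  fix a :: ereal
  have sub: "{x. g x \<le> ereal t} \<in> sets borel" for t
    using closed_fun_sublevel[OF assms] by (rule borel_closed)
  show "g -` {..a} \<inter> space borel \<in> sets borel"
  proof (cases a)
    case (real t)
    then show ?thesis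
      using sub[of t] by (simp add: vimage_def)
  next
    case PInf
    then show ?thesis
      by (simp add: vimage_def)
  next
    case MInf
    have "g -` {..a} \<inter> space borel = (\<Inter>n::nat. {x. g x \<le> ereal (- real n)})"
    proof (intro set_eqI iffI)
      fix x assume "x \<in> (\<Inter>n::nat. {x. g x \<le> ereal (- real n)})"
      then have "\<And>n::nat. g x \<le> ereal (- real n)"
        by auto
      then have le: "\<And>n::nat. g x \<le> ereal (- real n)" .
      have "g x \<noteq> ereal q" for q
      proof
        assume q: "g x = ereal q"
        obtain n where "- q < real n"
          using reals_Archimedean2 by blast
        with le[of n] q show False
          by simp
      qed
      moreover have "g x \<noteq> \<infinity>"
        using le[of 0] by auto
      ultimately have "g x = -\<infinity>"
        by (cases "g x") auto
      then show "x \<in> g -` {..a} \<inter> space borel"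
        using MInf by simp
    qed (use MInf in auto)
    then show ?thesis
      using sub by auto
  qed
qed

lemma closed_fun_attains_min:
  assumes "closed_fun g" "compact K" "K \<noteq> {}"
  shows "\<exists>x\<in>K. \<forall>y\<in>K. g x \<le> g (y :: 'a::metric_space)"
proof -
  obtain u where u: "\<And>n. u n \<in> g ` K" "u \<longlonglongrightarrow> Inf (g ` K)"
    using Inf_as_limit[of "g ` K"] assms(3) by auto
  from u(1) have "\<forall>n. \<exists>y. y \<in> K \<and> u n = g y"
    by blast
  then obtain X where X: "\<And>n. X n \<in> K" "\<And>n. u n = g (X n)"
    unfolding choice_iff by blast
  obtain x \<sigma> where x: "x \<in> K" "strict_mono (\<sigma> :: nat \<Rightarrow> nat)" "(X \<circ> \<sigma>) \<longlonglongrightarrow> x"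
    using assms(2) X(1) unfolding compact_def by metis
  have "g x \<le> Inf (g ` K)"
  proof (rule ccontr)
    assume "\<not> g x \<le> Inf (g ` K)"
    then obtain c where c: "Inf (g ` K) < c" "c < g x"
      using dense[of "Inf (g ` K)" "g x"] unfolding not_le by blast
    have "\<forall>\<^sub>F n in sequentially. c < g ((X \<circ> \<sigma>) n)"
      by (rule closed_fun_eventually_less[OF assms(1) x(3) c(2)])
    moreover have "(u \<circ> \<sigma>) \<longlonglongrightarrow> Inf (g ` K)"
      by (rule LIMSEQ_subseq_LIMSEQ[OF u(2) x(2)])
    then have "\<forall>\<^sub>F n in sequentially. (u \<circ> \<sigma>) n < c"
      using c(1) by (rule order_tendstoD)
    ultimately have "\<forall>\<^sub>F n::nat in sequentially. False"
      by eventually_elim (use X(2) in auto)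
    then show False
      by simp
  qed
  then show ?thesis
    using x(1) by (meson INF_lower order_trans)
qed

lemma closed_fun_add:
  assumes "closed_fun g" "closed_fun h" "\<And>x. g x \<noteq> -\<infinity>" "\<And>x. h x \<noteq> -\<infinity>"
  shows "closed_fun (\<lambda>x. g x + h (x :: 'a::metric_space))"
  unfolding closed_fun_def closed_sequential_limits
proof (intro allI impI)
  fix Z and z :: "'a \<times> real"
  assume "(\<forall>n. Z n \<in> {(x, t). g x + h x \<le> ereal t}) \<and> Z \<longlonglongrightarrow> z"
  then have Z: "\<And>n. g (fst (Z n)) + h (fst (Z n)) \<le> ereal (snd (Z n))"
    and lim: "(\<lambda>n. fst (Z n)) \<longlonglongrightarrow> fst z" "(\<lambda>n. snd (Z n)) \<longlonglongrightarrow> snd z"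
    by (auto intro: tendsto_intros simp: case_prod_beta)
  let ?x = "fst z"
  have "g ?x + h ?x \<le> ereal (snd z)"
  proof (rule ccontr)
    assume "\<not> ?thesis"
    then have less: "ereal (snd z) < g ?x + h ?x"
      by simp
    \<comment> \<open>Split the strict excess into strict lower bounds for the two summands separately.\<close>
    obtain a b where ab: "ereal a < g ?x" "ereal b < h ?x" "snd z < a + b"
    proof -
      consider p q where "g ?x = ereal p" "h ?x = ereal q" | p where "g ?x = ereal p" "h ?x = \<infinity>"
        | q where "g ?x = \<infinity>" "h ?x = ereal q" | "g ?x = \<infinity>" "h ?x = \<infinity>"
        using assms(3,4)[of ?x] by (cases "g ?x"; cases "h ?x") auto
      then show thesis
      proof cases
        case (1 p q)
        then have "snd z < p + q"
          using less by simp
        then show thesis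
          using 1 by (intro that[of "p - (p + q - snd z) / 3" "q - (p + q - snd z) / 3"])
            (auto simp: field_simps)
      next
        case (2 p)
        then show thesis
          by (intro that[of "p - 1" "snd z - p + 2"]) auto
      next
        case (3 q)
        then show thesis
          by (intro that[of "snd z - q + 2" "q - 1"]) auto
      next
        case 4
        then show thesis
          by (intro that[of "snd z" 1]) auto
      qed
    qed
    have "\<forall>\<^sub>F n in sequentially. False"
      using closed_fun_eventually_less[OF assms(1) lim(1) ab(1)]
        closed_fun_eventually_less[OF assms(2) lim(1) ab(2)] order_tendstoD(2)[OF lim(2) ab(3)]
    proof eventually_elim
      case (elim n)
      then have "ereal a + ereal b \<le> g (fst (Z n)) + h (fst (Z n))"
        by (intro add_mono) auto
      also have "\<dots> \<le> ereal (snd (Z n))"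
        by (rule Z)
      also have "\<dots> < ereal a + ereal b"
        using elim by simp
      finally show False
        by simp
    qed
    then show False
      by simp
  qed
  then show "z \<in> {(x, t). g x + h x \<le> ereal t}"
    by (simp add: case_prod_beta)
qed

lemma closed_fun_continuous:
  assumes "continuous_on UNIV q"
  shows "closed_fun (\<lambda>x. ereal (q x))"
proof -
  have "closed {z. q (fst z) \<le> (snd z :: real)}"
    by (intro closed_Collect_le continuous_intros continuous_on_compose2[OF assms]) auto
  then show ?thesis
    unfolding closed_fun_def by (simp add: case_prod_beta')
qed

lemma frechet_subset_limiting: "frechet_subdiff g x \<subseteq> limiting_subdiff g x"
proof
  fix v assume v: "v \<in> frechet_subdiff g x"
  then have "\<bar>g x\<bar> \<noteq> \<infinity>"
    by (simp add: frechet_subdiff_def)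
  moreover have "\<exists>X V. X \<longlonglongrightarrow> x \<and> (\<lambda>k. g (X k)) \<longlonglongrightarrow> g x \<and> V \<longlonglongrightarrow> v \<and>
      (\<forall>k::nat. V k \<in> frechet_subdiff g (X k))"
    by (rule exI[of _ "\<lambda>_. x"], rule exI[of _ "\<lambda>_. v"]) (use v in simp)
  ultimately show "v \<in> limiting_subdiff g x"
    unfolding limiting_subdiff_def by blast
qed

text \<open>Expanding the quadratic penalty around \<open>p\<close> gives its gradient as the linear term, and a
  remainder that is exactly quadratic in \<open>y - p\<close>, hence negligible to first order.\<close>

lemma frechet_subdiff_of_penalized_min:
  assumes fin: "\<bar>g p\<bar> \<noteq> \<infinity>" and "open B" "p \<in> B"
    and min: "\<And>y. y \<in> B \<Longrightarrow> g p + ereal (k * (norm (p - a))\<^sup>2) \<le> g y + ereal (k * (norm (y - a))\<^sup>2)"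
  shows "- (2 * k) *\<^sub>R (p - a) \<in> frechet_subdiff g p"
proof -
  let ?h = "\<lambda>y. - k * (norm (y - p))\<^sup>2"
  have "?h \<in> o[at p](\<lambda>y. norm (y - p))"
  proof (rule smalloI_tendsto)
    have "((\<lambda>y. - k * norm (y - p)) \<longlongrightarrow> - k * norm (p - p)) (at p)"
      by (intro tendsto_intros)
    then have "((\<lambda>y. - k * norm (y - p)) \<longlongrightarrow> 0) (at p)"
      by simp
    moreover have "\<forall>\<^sub>F y in at p. - k * norm (y - p) = ?h y / norm (y - p)"
      by (auto simp: eventually_at_filter power2_eq_square)
    ultimately show "((\<lambda>y. ?h y / norm (y - p)) \<longlongrightarrow> 0) (at p)"
      by (rule Lim_transform_eventually)
    show "\<forall>\<^sub>F y in at p. norm (y - p) \<noteq> 0"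
      by (auto simp: eventually_at_filter)
  qed
  moreover have "\<forall>\<^sub>F y in at p. g p + ereal ((- (2 * k) *\<^sub>R (p - a)) \<bullet> (y - p)) + ereal (?h y) \<le> g y"
  proof -
    have "\<forall>\<^sub>F y in at p. y \<in> B"
      using assms(2,3) by (simp add: eventually_at_topological) blast
    then show ?thesis
    proof eventually_elim
      case (elim y)
      have "y - a = (p - a) + (y - p)"
        by simp
      then have N: "(norm (y - a))\<^sup>2 = (norm (p - a))\<^sup>2 + 2 * ((p - a) \<bullet> (y - p)) + (norm (y - p))\<^sup>2"
        by (simp only: power2_norm_eq_inner) (simp add: algebra_simps inner_commute)
      then have eq: "(- (2 * k) *\<^sub>R (p - a)) \<bullet> (y - p) + ?h y = k * (norm (p - a))\<^sup>2 - k * (norm (y - a))\<^sup>2"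
        unfolding N inner_scaleR_left by (simp add: ring_distribs)
      obtain c where c: "g p = ereal c"
        using fin by auto
      show ?case
        using min[OF elim] eq c by (cases "g y") auto
    qed
  qed
  ultimately show ?thesis
    using fin unfolding frechet_subdiff_def mem_Collect_eq by (intro conjI bexI[of _ ?h])
qed

text \<open>Minimizing \<open>g + h + k (norm (\<cdot> - a))\<^sup>2\<close> over a compact ball around \<open>a\<close> gives points where \<open>g + h\<close>
  has a subgradient, and which tend to \<open>a\<close> as \<open>k\<close> grows. By minimality \<open>g + h\<close> is at most
  \<open>g a + h a\<close> there, so lower semicontinuity of each summand forces both \<open>g\<close> and \<open>h\<close> to converge to
  their values at \<open>a\<close>.\<close>

lemma dense_subdifferentiability:
  fixes g h :: "'a::euclidean_space \<Rightarrow> ereal"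
  assumes cl: "closed_fun g" "closed_fun h" and ninf: "\<And>x. g x \<noteq> -\<infinity>" "\<And>x. h x \<noteq> -\<infinity>"
    and a: "a \<in> edom g" "a \<in> edom h"
  obtains Y where "\<And>n::nat. limiting_subdiff (\<lambda>y. g y + h y) (Y n) \<noteq> {}"
    "\<And>n. Y n \<in> edom g" "\<And>n. Y n \<in> edom h" "Y \<longlonglongrightarrow> a"
    "(\<lambda>n. real_of_ereal (g (Y n))) \<longlonglongrightarrow> real_of_ereal (g a)"
    "(\<lambda>n. real_of_ereal (h (Y n))) \<longlonglongrightarrow> real_of_ereal (h a)"
proof -
  let ?G = "\<lambda>y. g y + h y"
  let ?g = "\<lambda>y. real_of_ereal (g y)" and ?h = "\<lambda>y. real_of_ereal (h y)"
  have real: "g y = ereal (?g y)" "h y = ereal (?h y)" if "?G y \<noteq> \<infinity>" for y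
    using that ninf[of y] by (cases "g y"; cases "h y"; simp)+
  have sum: "?G y = ereal (?g y + ?h y)" if "?G y \<noteq> \<infinity>" for y
    using real[OF that] by (metis plus_ereal.simps(1))
  have Ga: "?G a \<noteq> \<infinity>"
    using a ninf[of a] by (cases "g a"; cases "h a") (auto simp: edom_def)
  have clG: "closed_fun ?G"
    by (rule closed_fun_add[OF cl ninf])
  define pen where "pen k y = ?G y + ereal (real k * (norm (y - a))\<^sup>2)" for k :: nat and y
  have clpen: "closed_fun (pen k)" for k
    unfolding pen_def
    by (intro closed_fun_add clG closed_fun_continuous continuous_intros) (use ninf in auto)
  have "\<exists>p\<in>cball a 1. \<forall>y\<in>cball a 1. pen k p \<le> pen k y" for k
    by (rule closed_fun_attains_min[OF clpen]) auto
  then obtain p where p: "\<And>k. p k \<in> cball a 1" "\<And>k y. y \<in> cball a 1 \<Longrightarrow> pen k (p k) \<le> pen k y"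
    by metis
  have pa: "pen k (p k) \<le> ?G a" for k
    using p(2)[of a k] by (simp add: pen_def)
  have Gp: "?G (p k) \<noteq> \<infinity>" for k
    using pa[of k] Ga by (auto simp: pen_def)
  have le: "?g (p k) + ?h (p k) + real k * (norm (p k - a))\<^sup>2 \<le> ?g a + ?h a" for k
  proof -
    have "ereal (?g (p k) + ?h (p k) + real k * (norm (p k - a))\<^sup>2) \<le> ereal (?g a + ?h a)"
      using pa[of k] unfolding pen_def sum[OF Ga] sum[OF Gp[of k]] by simp
    then show ?thesis by simp
  qed
  obtain B where B: "\<And>k. B \<le> ?g (p k) + ?h (p k)"
  proof -
    have "?g (p 0) + ?h (p 0) \<le> ?g (p k) + ?h (p k)" for k
      using p(2)[OF p(1), of 0 k] unfolding pen_def sum[OF Gp[of 0]] sum[OF Gp[of k]] by simp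
    then show thesis
      by (rule that)
  qed
  have lim: "p \<longlonglongrightarrow> a"
  proof -
    have bound: "(norm (p k - a))\<^sup>2 \<le> (?g a + ?h a - B) / real k" if "k > 0" for k
      using le[of k] B[of k] that by (simp add: field_simps)
    have "(\<lambda>k. (norm (p k - a))\<^sup>2) \<longlonglongrightarrow> 0"
    proof (rule tendsto_sandwich[OF _ _ tendsto_const])
      show "\<forall>\<^sub>F k in sequentially. (norm (p k - a))\<^sup>2 \<le> (?g a + ?h a - B) / real k"
        using eventually_gt_at_top[of 0] by eventually_elim (rule bound)
      show "(\<lambda>k. (?g a + ?h a - B) / real k) \<longlonglongrightarrow> 0"
        by (rule lim_const_over_n)
    qed simp
    then have "(\<lambda>k. sqrt ((norm (p k - a))\<^sup>2)) \<longlonglongrightarrow> sqrt 0"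
      by (rule tendsto_real_sqrt)
    then have "(\<lambda>k. norm (p k - a)) \<longlonglongrightarrow> 0"
      by simp
    then show ?thesis
      using LIM_zero_iff tendsto_norm_zero_iff by blast
  qed
  have low: "\<forall>\<^sub>F k in sequentially. ?g a - e < ?g (p k)" "\<forall>\<^sub>F k in sequentially. ?h a - e < ?h (p k)"
    if "e > 0" for e
  proof -
    have "ereal (?g a - e) < ereal (?g a)" "ereal (?h a - e) < ereal (?h a)"
      using that by simp_all
    then have *: "ereal (?g a - e) < g a" "ereal (?h a - e) < h a"
      unfolding real[OF Ga, symmetric] .
    show "\<forall>\<^sub>F k in sequentially. ?g a - e < ?g (p k)"
      using closed_fun_eventually_less[OF cl(1) lim *(1)]
    proof eventually_elim
      case (elim k)
      then have "ereal (?g a - e) < ereal (?g (p k))"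
        unfolding real(1)[OF Gp, symmetric] .
      then show ?case
        by simp
    qed
    show "\<forall>\<^sub>F k in sequentially. ?h a - e < ?h (p k)"
      using closed_fun_eventually_less[OF cl(2) lim *(2)]
    proof eventually_elim
      case (elim k)
      then have "ereal (?h a - e) < ereal (?h (p k))"
        unfolding real(2)[OF Gp, symmetric] .
      then show ?case
        by simp
    qed
  qed
  have le': "?g (p k) + ?h (p k) \<le> ?g a + ?h a" for k
  proof -
    have "0 \<le> real k * (norm (p k - a))\<^sup>2"
      by simp
    then show ?thesis
      using le[of k] by linarith
  qed
  \<comment> \<open>The sum is bounded above and each summand below, so neither summand can exceed its limit by much.\<close>
  have limg: "(\<lambda>k. ?g (p k)) \<longlonglongrightarrow> ?g a"
  proof (rule tendstoI)
    fix e :: real assume "e > 0"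
    from low[OF this] show "\<forall>\<^sub>F k in sequentially. dist (?g (p k)) (?g a) < e"
    proof eventually_elim
      case (elim k)
      then show ?case
        using le'[of k] by (simp add: dist_real_def abs_less_iff)
    qed
  qed
  have limh: "(\<lambda>k. ?h (p k)) \<longlonglongrightarrow> ?h a"
  proof (rule tendstoI)
    fix e :: real assume "e > 0"
    from low[OF this] show "\<forall>\<^sub>F k in sequentially. dist (?h (p k)) (?h a) < e"
    proof eventually_elim
      case (elim k)
      then show ?case
        using le'[of k] by (simp add: dist_real_def abs_less_iff)
    qed
  qed
  have sub: "limiting_subdiff ?G (p k) \<noteq> {}" if "p k \<in> ball a 1" for k
  proof -
    have "- (2 * real k) *\<^sub>R (p k - a) \<in> frechet_subdiff ?G (p k)"
    proof (rule frechet_subdiff_of_penalized_min[OF _ open_ball that])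
      show "\<bar>?G (p k)\<bar> \<noteq> \<infinity>"
        using Gp[of k] ninf by auto
      show "?G (p k) + ereal (real k * (norm (p k - a))\<^sup>2) \<le> ?G y + ereal (real k * (norm (y - a))\<^sup>2)"
        if "y \<in> ball a 1" for y
        using p(2)[of y k] that unfolding pen_def by auto
    qed
    then show ?thesis
      using frechet_subset_limiting by blast
  qed
  have "\<forall>\<^sub>F k in sequentially. p k \<in> ball a 1"
    by (rule topological_tendstoD[OF lim]) auto
  then obtain N where N: "\<And>k. k \<ge> N \<Longrightarrow> p k \<in> ball a 1"
    unfolding eventually_sequentially by blast
  \<comment> \<open>Discard the first \<open>N\<close> minimizers, which may lie on the boundary of the ball.\<close>
  show thesis
  proof (rule that[of "\<lambda>n. p (n + N)"])
    show "limiting_subdiff ?G (p (n + N)) \<noteq> {}" for n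
      by (rule sub[OF N]) simp
    show "p (n + N) \<in> edom g" "p (n + N) \<in> edom h" for n
      using Gp[of "n + N"] ninf[of "p (n + N)"] by (auto simp: edom_def)
  qed (intro LIMSEQ_ignore_initial_segment lim limg limh)+
qed

section \<open>One stochastic proximal step\<close>

text \<open>The divergence \<open>D(\<cdot>, x)\<close> differs from \<open>\<Phi>\<close> by an affine function, so the subproblem objective minus
  \<open>(\<alpha> + \<mu>) \<Phi>\<close> is still convex. Comparing \<open>p\<close> with the points \<open>p + s (y - p)\<close>, dividing by
  \<open>s\<close> and letting \<open>s\<close> tend to \<open>0\<close> turns the increments of \<open>\<Phi>\<close> into its gradient at \<open>p\<close>, which
  produces \<open>D(y, p)\<close>.\<close>

lemma bregman_three_point:
  fixes \<Phi> :: "'a::euclidean_space \<Rightarrow> ereal"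
  assumes leg: "legendre \<Phi>" and rninf: "\<And>z. r z \<noteq> -\<infinity>"
    and conv: "rel_strongly_convex_on (interior (edom \<Phi>)) \<mu> \<Phi> (\<lambda>y. ereal (q y) + r y)"
    and x: "x \<in> interior (edom \<Phi>)" and y: "y \<in> interior (edom \<Phi>)" "y \<in> edom r"
    and min: "is_arg_min (\<lambda>y. ereal (q y) + r y + ereal \<alpha> * bregman \<Phi> y x) (\<lambda>y. y \<in> interior (edom \<Phi>)) p"
  shows "p \<in> edom r" and
    "q p + real_of_ereal (r p) + \<alpha> * real_bregman \<Phi> p x + (\<alpha> + \<mu>) * real_bregman \<Phi> y p
      \<le> q y + real_of_ereal (r y) + \<alpha> * real_bregman \<Phi> y x"
proof -
  let ?U = "interior (edom \<Phi>)"
  let ?\<phi> = "\<lambda>y. real_of_ereal (\<Phi> y)" and ?r = "\<lambda>y. real_of_ereal (r y)"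
  let ?D = "real_bregman \<Phi>"
  have U: "?U \<subseteq> edom \<Phi>"
    by (rule interior_subset)
  have pU: "p \<in> ?U"
    using min by (simp add: is_arg_min_def)
  have fin: "\<Phi> z = ereal (?\<phi> z)" if "z \<in> ?U" for z
    using leg that U by (intro ereal_real_edom) (auto simp: legendre_def)
  have rfin: "r z = ereal (?r z)" if "z \<in> edom r" for z
    using rninf that by (rule ereal_real_edom)
  have breg: "bregman \<Phi> z x = ereal (?D z x)"
    and D: "?D z w = ?\<phi> z - ?\<phi> w - egrad \<Phi> w \<bullet> (z - w)" if "z \<in> ?U" "w \<in> ?U" for z w
    using bregman_eq_real[OF leg x, of z] bregman_eq_real[OF leg that(2), of z] that U by auto
  have minle: "ereal (q p) + r p + ereal (\<alpha> * ?D p x) \<le> ereal (q z) + r z + ereal (\<alpha> * ?D z x)"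
    if "z \<in> ?U" for z
  proof -
    have eq: "ereal (\<alpha> * ?D w x) = ereal \<alpha> * bregman \<Phi> w x" if "w \<in> ?U" for w
      by (subst breg[OF that x]) simp
    show ?thesis
      using min that unfolding eq[OF that] eq[OF pU] by (simp add: is_arg_min_def not_less)
  qed
  show p: "p \<in> edom r"
  proof -
    have "ereal (q p) + r p + ereal (\<alpha> * ?D p x) \<le> ereal (q y + ?r y + \<alpha> * ?D y x)"
      using minle[OF y(1)] rfin[OF y(2)] by (metis plus_ereal.simps(1))
    then show ?thesis
      unfolding edom_def by (cases "r p") auto
  qed
  have segment: "q p + ?r p + \<alpha> * ?D p x + (\<alpha> + \<mu>) * (?\<phi> y - ?\<phi> p)
        - (q y + ?r y + \<alpha> * ?D y x)
      \<le> (\<alpha> + \<mu>) * ((?\<phi> (p + s *\<^sub>R (y - p)) - ?\<phi> p) / s)"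
    if s: "0 < s" "s < 1" for s
  proof -
    define z where "z = p + s *\<^sub>R (y - p)"
    have z_alt: "z = (1 - s) *\<^sub>R p + s *\<^sub>R y"
      by (simp add: z_def algebra_simps)
    have zU: "z \<in> ?U"
      unfolding z_alt using convexD_alt[OF convex_interior[OF convex_edom_legendre[OF leg]] pU y(1)] s
      by simp
    have "ereal (q z) + r z - ereal \<mu> * \<Phi> z
        \<le> ereal (1 - s) * (ereal (q p) + r p - ereal \<mu> * \<Phi> p)
          + ereal s * (ereal (q y) + r y - ereal \<mu> * \<Phi> y)"
      using conv pU y(1) s unfolding z_alt rel_strongly_convex_on_def convex_efun_on_def by simp
    then have "ereal (q z) + r z - ereal (\<mu> * ?\<phi> z)
        \<le> ereal ((1 - s) * (q p + ?r p - \<mu> * ?\<phi> p) + s * (q y + ?r y - \<mu> * ?\<phi> y))"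
      by (subst (asm) fin[OF zU], subst (asm) fin[OF pU], subst (asm) fin[OF y(1)],
          subst (asm) rfin[OF p], subst (asm) rfin[OF y(2)]) simp
    moreover from this have zr: "r z = ereal (?r z)"
      using rninf[of z] by (cases "r z") auto
    ultimately have conv': "q z + ?r z - \<mu> * ?\<phi> z
        \<le> (1 - s) * (q p + ?r p - \<mu> * ?\<phi> p) + s * (q y + ?r y - \<mu> * ?\<phi> y)"
      by (metis ereal_less_eq(3) ereal_minus(1) plus_ereal.simps(1))
    have min': "q p + ?r p + \<alpha> * ?D p x \<le> q z + ?r z + \<alpha> * ?D z x"
      using minle[OF zU] by (subst (asm) zr, subst (asm) rfin[OF p]) simp
    have lin: "egrad \<Phi> x \<bullet> (z - x) = (1 - s) * (egrad \<Phi> x \<bullet> (p - x)) + s * (egrad \<Phi> x \<bullet> (y - x))"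
      unfolding z_alt by (simp add: algebra_simps inner_add_right inner_diff_right)
    have "q p + ?r p + \<alpha> * ?D p x - (\<alpha> + \<mu>) * ?\<phi> z
        \<le> (1 - s) * (q p + ?r p + \<alpha> * ?D p x - (\<alpha> + \<mu>) * ?\<phi> p)
          + s * (q y + ?r y + \<alpha> * ?D y x - (\<alpha> + \<mu>) * ?\<phi> y)"
      using min' conv' unfolding D[OF zU x] D[OF pU x] D[OF y(1) x] lin
      by (simp add: algebra_simps)
    then have "s * (q p + ?r p + \<alpha> * ?D p x + (\<alpha> + \<mu>) * (?\<phi> y - ?\<phi> p)
        - (q y + ?r y + \<alpha> * ?D y x)) \<le> (\<alpha> + \<mu>) * (?\<phi> z - ?\<phi> p)"
      by (simp add: algebra_simps)
    then show ?thesis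
      using s unfolding z_def by (simp add: field_simps)
  qed
  have "q p + ?r p + \<alpha> * ?D p x + (\<alpha> + \<mu>) * (?\<phi> y - ?\<phi> p) - (q y + ?r y + \<alpha> * ?D y x)
      \<le> (\<alpha> + \<mu>) * (egrad \<Phi> p \<bullet> (y - p))"
  proof (rule tendsto_lowerbound)
    show "((\<lambda>s. (\<alpha> + \<mu>) * ((?\<phi> (p + s *\<^sub>R (y - p)) - ?\<phi> p) / s))
        \<longlongrightarrow> (\<alpha> + \<mu>) * (egrad \<Phi> p \<bullet> (y - p))) (at_right 0)"
      by (intro tendsto_intros directional_derivative_egrad leg pU)
    show "\<forall>\<^sub>F s in at_right 0. q p + ?r p + \<alpha> * ?D p x + (\<alpha> + \<mu>) * (?\<phi> y - ?\<phi> p)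
        - (q y + ?r y + \<alpha> * ?D y x) \<le> (\<alpha> + \<mu>) * ((?\<phi> (p + s *\<^sub>R (y - p)) - ?\<phi> p) / s)"
      unfolding eventually_at_right_field by (intro exI[of _ 1]) (use segment in simp)
  qed simp
  then show "q p + ?r p + \<alpha> * ?D p x + (\<alpha> + \<mu>) * ?D y p \<le> q y + ?r y + \<alpha> * ?D y x"
    unfolding D[OF y(1) pU] by (simp add: algebra_simps)
qed

text \<open>This is the expected decrease of the potential \<open>(r - \<rho>) + \<alpha> D(y, \<cdot>)\<close> in one step from \<open>x\<close>. Writing
  \<open>f x = (F x - v) - (r x - \<rho>) + (v - \<rho>)\<close> makes all terms nonnegative, so that the inequality can be stated
  without integrability conditions; for \<open>x\<close> outside the domain of \<open>r\<close> its right-hand side is infinite.\<close>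

lemma stochastic_step:
  fixes \<Phi> :: "'a::euclidean_space \<Rightarrow> ereal" and m :: "'a \<Rightarrow> 'a \<Rightarrow> 'w \<Rightarrow> real"
  assumes leg: "legendre \<Phi>" and rninf: "\<And>z. r z \<noteq> -\<infinity>"
    and "prob_space P" and "\<mu> > 0" and "\<alpha> > 0"
    and unb: "unbiased_lower_model \<Phi> f r P m"
    and conv: "rel_strongly_convex_model \<Phi> r P m \<mu>"
    and lip: "rel_lipschitz_model \<Phi> r P m L Lbar"
    and rlow: "\<And>z. ereal \<rho> \<le> r z" and Flow: "\<And>z. ereal v \<le> ereal (f z) + r z"
    and x: "x \<in> interior (edom \<Phi>)" and y: "y \<in> interior (edom \<Phi>)" "y \<in> edom r"
    and min: "AE \<xi> in P. is_arg_min (\<lambda>z. ereal (m x z \<xi>) + r z + ereal \<alpha> * bregman \<Phi> z x)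
        (\<lambda>z. z \<in> interior (edom \<Phi>)) (s \<xi>)"
  shows "(\<integral>\<^sup>+\<xi>. e2ennreal (r (s \<xi>) - ereal \<rho>) + ennreal ((\<alpha> + \<mu>) * real_bregman \<Phi> y (s \<xi>)) \<partial>P)
        + e2ennreal (ereal (f x) + r x - ereal v)
      \<le> e2ennreal (r x - ereal \<rho>) + ennreal (\<alpha> * real_bregman \<Phi> y x)
        + ennreal (f y + real_of_ereal (r y) - v + Lbar\<^sup>2 / (4 * \<alpha>))"
proof (cases "x \<in> edom r")
  case False
  then have "r x = \<infinity>"
    by (simp add: edom_def)
  then show ?thesis
    by simp
next
  case True
  let ?U = "interior (edom \<Phi>)" and ?r = "\<lambda>y. real_of_ereal (r y)" and ?D = "real_bregman \<Phi>"
  interpret prob_space P by fact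
  have rfin: "r z = ereal (?r z)" if "z \<in> edom r" for z
    using rninf that by (rule ereal_real_edom)
  have Fx: "v \<le> f x + ?r x" and Fy: "v \<le> f y + ?r y"
    using Flow[of x] Flow[of y] rfin[OF True] rfin[OF y(2)] by (metis ereal_less_eq(3) plus_ereal.simps(1))+
  have rx: "\<rho> \<le> ?r x"
    using rlow[of x] rfin[OF True] by (metis ereal_less_eq(3))
  \<comment> \<open>An integrable majorant of the next potential: the expectations of its model values are known
      because the base point \<open>x\<close> is fixed.\<close>
  define h where "h \<xi> = (m x y \<xi> - m x x \<xi>) + (?r y - \<rho> + \<alpha> * ?D y x) + (1 / (4 * \<alpha>)) * (L \<xi>)\<^sup>2" for \<xi>
  have le_h: "AE \<xi> in P. s \<xi> \<in> edom r \<and> 0 \<le> ?r (s \<xi>) - \<rho> \<and> 0 \<le> ?D y (s \<xi>) \<and>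
      ?r (s \<xi>) - \<rho> + (\<alpha> + \<mu>) * ?D y (s \<xi>) \<le> h \<xi>"
  proof -
    have "AE \<xi> in P. rel_strongly_convex_on ?U \<mu> \<Phi> (\<lambda>y. ereal (m x y \<xi>) + r y)"
      using conv x True by (simp add: rel_strongly_convex_model_def Let_def)
    moreover have "AE \<xi> in P. \<forall>y\<in>?U \<inter> edom r. m x x \<xi> - m x y \<xi> \<le> L \<xi> * sqrt (?D y x)"
      using lip x True by (simp add: rel_lipschitz_model_def Let_def)
    ultimately show ?thesis
      using min
    proof eventually_elim
      case (elim \<xi>)
      have sU: "s \<xi> \<in> ?U"
        using elim(3) by (simp add: is_arg_min_def)
      have sr: "s \<xi> \<in> edom r"
        by (rule bregman_three_point(1)[OF leg rninf elim(1) x y elim(3)])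
      have D: "0 \<le> ?D (s \<xi>) x" "0 \<le> ?D y (s \<xi>)"
        using sU x y(1) interior_subset by (blast intro: real_bregman_nonneg[OF leg])+
      have "m x x \<xi> - m x (s \<xi>) \<xi> \<le> L \<xi> * sqrt (?D (s \<xi>) x)"
        using elim(2) sU sr by blast
      moreover have "L \<xi> * sqrt (?D (s \<xi>) x) - \<alpha> * ?D (s \<xi>) x \<le> (1 / (4 * \<alpha>)) * (L \<xi>)\<^sup>2"
      proof -
        \<comment> \<open>Young's inequality, by completing the square.\<close>
        have "0 \<le> (L \<xi> - 2 * \<alpha> * sqrt (?D (s \<xi>) x))\<^sup>2"
          by simp
        also have "\<dots> = (L \<xi>)\<^sup>2 - 4 * \<alpha> * (L \<xi> * sqrt (?D (s \<xi>) x)) + 4 * \<alpha>\<^sup>2 * (sqrt (?D (s \<xi>) x))\<^sup>2"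
          by (simp add: power2_eq_square algebra_simps)
        also have "(sqrt (?D (s \<xi>) x))\<^sup>2 = ?D (s \<xi>) x"
          using D by simp
        finally show ?thesis
          using \<open>\<alpha> > 0\<close> by (simp add: field_simps power2_eq_square)
      qed
      moreover note bregman_three_point(2)[OF leg rninf elim(1) x y elim(3)]
      ultimately have "?r (s \<xi>) - \<rho> + (\<alpha> + \<mu>) * ?D y (s \<xi>) \<le> h \<xi>"
        unfolding h_def by linarith
      moreover have "\<rho> \<le> ?r (s \<xi>)"
        using rlow[of "s \<xi>"] rfin[OF sr] by (metis ereal_less_eq(3))
      ultimately show ?case
        using sr D by simp
    qed
  qed
  have int: "integrable P (m x y)" "integrable P (m x x)" "integrable P (\<lambda>\<xi>. (L \<xi>)\<^sup>2)"
    using unb lip x y True by (auto simp: unbiased_lower_model_def rel_lipschitz_model_def Let_def)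
  have exy: "(\<integral>\<xi>. m x y \<xi> \<partial>P) \<le> f y" "(\<integral>\<xi>. m x x \<xi> \<partial>P) = f x"
    using unb x y True by (auto simp: unbiased_lower_model_def Let_def)
  have eL: "(\<integral>\<xi>. (L \<xi>)\<^sup>2 \<partial>P) \<le> Lbar\<^sup>2"
    using lip by (auto simp: rel_lipschitz_model_def Let_def intro: sqrt_le_D)
  have hint: "integrable P h"
    unfolding h_def using int by auto
  have "(\<integral>\<xi>. h \<xi> \<partial>P) = (\<integral>\<xi>. m x y \<xi> \<partial>P) - (\<integral>\<xi>. m x x \<xi> \<partial>P) + (?r y - \<rho> + \<alpha> * ?D y x)
      + (1 / (4 * \<alpha>)) * (\<integral>\<xi>. (L \<xi>)\<^sup>2 \<partial>P)"
    unfolding h_def using int by (simp add: prob_space)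
  also have "\<dots> \<le> f y - f x + (?r y - \<rho> + \<alpha> * ?D y x) + (1 / (4 * \<alpha>)) * Lbar\<^sup>2"
    using exy eL \<open>\<alpha> > 0\<close> by (intro add_mono diff_mono mult_left_mono) auto
  finally have eh: "(\<integral>\<xi>. h \<xi> \<partial>P) \<le> f y - f x + (?r y - \<rho> + \<alpha> * ?D y x) + Lbar\<^sup>2 / (4 * \<alpha>)"
    by simp
  have hpos: "AE \<xi> in P. 0 \<le> h \<xi>"
    using le_h
  proof eventually_elim
    case (elim \<xi>)
    then have "0 \<le> (\<alpha> + \<mu>) * ?D y (s \<xi>)"
      using \<open>\<alpha> > 0\<close> \<open>\<mu> > 0\<close> by simp
    then show ?case
      using elim by linarith
  qed
  have "(\<integral>\<^sup>+\<xi>. e2ennreal (r (s \<xi>) - ereal \<rho>) + ennreal ((\<alpha> + \<mu>) * ?D y (s \<xi>)) \<partial>P)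
      \<le> (\<integral>\<^sup>+\<xi>. ennreal (h \<xi>) \<partial>P)"
  proof (rule nn_integral_mono_AE, use le_h in eventually_elim)
    case (elim \<xi>)
    then have "r (s \<xi>) = ereal (?r (s \<xi>))"
      by (intro rfin) simp
    then have "e2ennreal (r (s \<xi>) - ereal \<rho>) = ennreal (?r (s \<xi>) - \<rho>)"
      by (metis e2ennreal_ereal ereal_minus(1))
    moreover have "0 \<le> (\<alpha> + \<mu>) * ?D y (s \<xi>)"
      using elim \<open>\<alpha> > 0\<close> \<open>\<mu> > 0\<close> by simp
    ultimately show ?case
      using elim by (simp add: ennreal_leI flip: ennreal_plus)
  qed
  also have "\<dots> = ennreal (\<integral>\<xi>. h \<xi> \<partial>P)"
    by (rule nn_integral_eq_integral[OF hint hpos])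
  also have "\<dots> \<le> ennreal (f y - f x + (?r y - \<rho> + \<alpha> * ?D y x) + Lbar\<^sup>2 / (4 * \<alpha>))"
    by (rule ennreal_leI[OF eh])
  finally have step: "(\<integral>\<^sup>+\<xi>. e2ennreal (r (s \<xi>) - ereal \<rho>) + ennreal ((\<alpha> + \<mu>) * ?D y (s \<xi>)) \<partial>P)
      \<le> ennreal (f y - f x + (?r y - \<rho> + \<alpha> * ?D y x) + Lbar\<^sup>2 / (4 * \<alpha>))" .
  have Gx: "e2ennreal (ereal (f x) + r x - ereal v) = ennreal (f x + ?r x - v)"
    by (subst rfin[OF True]) simp
  have Rx: "e2ennreal (r x - ereal \<rho>) = ennreal (?r x - \<rho>)"
    by (subst rfin[OF True]) simp
  have sum: "ennreal (f y - f x + (?r y - \<rho> + \<alpha> * ?D y x) + Lbar\<^sup>2 / (4 * \<alpha>)) + ennreal (f x + ?r x - v)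
      = ennreal (?r x - \<rho>) + ennreal (\<alpha> * ?D y x) + ennreal (f y + ?r y - v + Lbar\<^sup>2 / (4 * \<alpha>))"
  proof -
    have "0 \<le> \<alpha> * ?D y x"
      using \<open>\<alpha> > 0\<close> x y(1) interior_subset by (intro mult_nonneg_nonneg real_bregman_nonneg[OF leg]) auto
    moreover have "0 \<le> (\<integral>\<xi>. h \<xi> \<partial>P)"
      by (rule integral_nonneg_AE[OF hpos])
    moreover have "0 \<le> Lbar\<^sup>2 / (4 * \<alpha>)"
      using \<open>\<alpha> > 0\<close> by simp
    ultimately show ?thesis
      using Fx Fy rx eh by (simp add: algebra_simps flip: ennreal_plus)
  qed
  show ?thesis
    unfolding Gx Rx using add_right_mono[OF step, of "ennreal (f x + ?r x - v)"] unfolding sum .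
qed

section \<open>Convexity of the objective and averaging\<close>

text \<open>Take the model based at the convex combination \<open>w\<close> of \<open>y\<close> and \<open>z\<close>: it is convex relative to
  \<open>\<Phi>\<close>, its expectation equals \<open>f\<close> at \<open>w\<close> and is at most \<open>f\<close> at \<open>y\<close> and \<open>z\<close>. Integrating its
  convexity inequality yields the one for \<open>F - \<mu> \<Phi>\<close>, to which the convex function \<open>\<mu> \<Phi>\<close> is added.\<close>

lemma objective_convex:
  fixes \<Phi> :: "'a::euclidean_space \<Rightarrow> ereal" and m :: "'a \<Rightarrow> 'a \<Rightarrow> 'w \<Rightarrow> real"
  assumes leg: "legendre \<Phi>" and rninf: "\<And>z. r z \<noteq> -\<infinity>" and "convex (edom r)"
    and "prob_space P" and "\<mu> > 0"
    and unb: "unbiased_lower_model \<Phi> f r P m"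
    and conv: "rel_strongly_convex_model \<Phi> r P m \<mu>"
  shows "convex_on (interior (edom \<Phi>) \<inter> edom r) (\<lambda>y. f y + real_of_ereal (r y))"
proof (rule convex_onI)
  let ?U = "interior (edom \<Phi>)" and ?r = "\<lambda>y. real_of_ereal (r y)" and ?\<phi> = "\<lambda>y. real_of_ereal (\<Phi> y)"
  show conv_dom: "convex (?U \<inter> edom r)"
    using convex_edom_legendre[OF leg] \<open>convex (edom r)\<close> by (intro convex_Int convex_interior)
  interpret prob_space P by fact
  fix t :: real and y z assume t: "0 < t" "t < 1" and y: "y \<in> ?U \<inter> edom r" and z: "z \<in> ?U \<inter> edom r"
  define w where "w = (1 - t) *\<^sub>R y + t *\<^sub>R z"
  have w: "w \<in> ?U \<inter> edom r"
    unfolding w_def using convexD_alt[OF conv_dom y z] t by simp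
  have rfin: "r p = ereal (?r p)" if "p \<in> ?U \<inter> edom r" for p
    using that rninf by (intro ereal_real_edom) auto
  have fin: "\<Phi> p = ereal (?\<phi> p)" if "p \<in> ?U \<inter> edom r" for p
    using that leg interior_subset[of "edom \<Phi>"] by (intro ereal_real_edom) (auto simp: legendre_def)
  have int: "integrable P (m w p)" "(\<integral>\<xi>. m w p \<xi> \<partial>P) \<le> f p" if "p \<in> ?U \<inter> edom r" for p
    using unb w that by (auto simp: unbiased_lower_model_def Let_def)
  have eq: "(\<integral>\<xi>. m w w \<xi> \<partial>P) = f w"
    using unb w by (auto simp: unbiased_lower_model_def Let_def)
  have "AE \<xi> in P. rel_strongly_convex_on ?U \<mu> \<Phi> (\<lambda>y. ereal (m w y \<xi>) + r y)"
    using conv w unfolding rel_strongly_convex_model_def Let_def by blast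
  then have "AE \<xi> in P. m w w \<xi> + (?r w - \<mu> * ?\<phi> w)
      \<le> (1 - t) * (m w y \<xi> + (?r y - \<mu> * ?\<phi> y)) + t * (m w z \<xi> + (?r z - \<mu> * ?\<phi> z))"
  proof eventually_elim
    case (elim \<xi>)
    have "ereal (m w w \<xi>) + r w - ereal \<mu> * \<Phi> w
        \<le> ereal (1 - t) * (ereal (m w y \<xi>) + r y - ereal \<mu> * \<Phi> y)
          + ereal t * (ereal (m w z \<xi>) + r z - ereal \<mu> * \<Phi> z)"
      using elim y z t unfolding w_def rel_strongly_convex_on_def convex_efun_on_def by simp
    then show ?case
      by (subst (asm) fin[OF w], subst (asm) fin[OF y], subst (asm) fin[OF z],
          subst (asm) rfin[OF w], subst (asm) rfin[OF y], subst (asm) rfin[OF z])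
        (simp add: algebra_simps)
  qed
  then have "(\<integral>\<xi>. m w w \<xi> + (?r w - \<mu> * ?\<phi> w) \<partial>P)
      \<le> (\<integral>\<xi>. (1 - t) * (m w y \<xi> + (?r y - \<mu> * ?\<phi> y)) + t * (m w z \<xi> + (?r z - \<mu> * ?\<phi> z)) \<partial>P)"
    using int(1)[OF w] int(1)[OF y] int(1)[OF z] by (intro integral_mono_AE) auto
  then have "f w + (?r w - \<mu> * ?\<phi> w)
      \<le> (1 - t) * ((\<integral>\<xi>. m w y \<xi> \<partial>P) + (?r y - \<mu> * ?\<phi> y)) + t * ((\<integral>\<xi>. m w z \<xi> \<partial>P) + (?r z - \<mu> * ?\<phi> z))"
    using int(1)[OF w] int(1)[OF y] int(1)[OF z] by (simp add: eq prob_space)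
  also have "\<dots> \<le> (1 - t) * (f y + (?r y - \<mu> * ?\<phi> y)) + t * (f z + (?r z - \<mu> * ?\<phi> z))"
    using int(2)[OF y] int(2)[OF z] t by (intro add_mono mult_left_mono) auto
  finally have "f w + ?r w + \<mu> * ((1 - t) * ?\<phi> y + t * ?\<phi> z - ?\<phi> w)
      \<le> (1 - t) * (f y + ?r y) + t * (f z + ?r z)"
    by (simp add: algebra_simps)
  moreover have "0 \<le> \<mu> * ((1 - t) * ?\<phi> y + t * ?\<phi> z - ?\<phi> w)"
  proof -
    have "?\<phi> w \<le> (1 - t) * ?\<phi> y + t * ?\<phi> z"
      unfolding w_def using y z t interior_subset[of "edom \<Phi>"]
      by (intro convex_onD[OF convex_on_legendre[OF leg]]) auto
    then show ?thesis
      using \<open>\<mu> > 0\<close> by simp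
  qed
  ultimately show "f ((1 - t) *\<^sub>R y + t *\<^sub>R z) + ?r ((1 - t) *\<^sub>R y + t *\<^sub>R z)
      \<le> (1 - t) * (f y + ?r y) + t * (f z + ?r z)"
    unfolding w_def by linarith
qed

text \<open>Jensen's inequality for the gap \<open>H - v\<close> of an extended real function \<open>H\<close>. In \<open>ennreal\<close> it
  survives points outside the domain of \<open>H\<close>, since the sum of the gaps is then infinite.\<close>

lemma gap_average_le:
  assumes "convex_on C F'" and xC: "\<And>t. t \<le> n \<Longrightarrow> x t \<in> A" and C: "C = {a\<in>A. H a < \<infinity>}"
    and F': "\<And>a. a \<in> C \<Longrightarrow> H a = ereal (F' a)" and low: "\<And>a. ereal v \<le> H a"
  shows "ennreal (real n + 1) * e2ennreal (H ((1 / (real n + 1)) *\<^sub>R (\<Sum>t=0..n. x t)) - ereal v)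
      \<le> (\<Sum>t<Suc n. e2ennreal (H (x t) - ereal v))"
proof (cases "\<forall>t\<le>n. x t \<in> C")
  case False
  then obtain t where t: "t \<le> n" "H (x t) = \<infinity>"
    using xC C by auto
  then have "e2ennreal (H (x t) - ereal v) = \<top>"
    by simp
  then have "(\<Sum>t<Suc n. e2ennreal (H (x t) - ereal v)) = \<top>"
    using t(1) by (auto simp: ennreal_sum_eq_top simp del: sum.lessThan_Suc intro!: bexI[of _ t])
  then show ?thesis
    by (simp only: top_greatest)
next
  case True
  let ?w = "(1 / (real n + 1)) *\<^sub>R (\<Sum>t=0..n. x t)"
  have w: "?w = (\<Sum>t\<in>{0..n}. (1 / (real n + 1)) *\<^sub>R x t)"
    by (rule scaleR_sum_right)
  have xt: "x t \<in> C" if "t \<in> {0..n}" for t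
    using that True by simp
  have wC: "?w \<in> C"
    unfolding w by (rule convex_sum[OF _ convex_on_imp_convex[OF assms(1)]]) (use xt in auto)
  have "F' ?w \<le> (\<Sum>t\<in>{0..n}. (1 / (real n + 1)) * F' (x t))"
    unfolding w by (rule convex_on_sum[OF _ _ assms(1)]) (use xt in auto)
  also have "\<dots> = (1 / (real n + 1)) * (\<Sum>t\<in>{0..n}. F' (x t))"
    by (simp add: sum_distrib_left)
  finally have "(real n + 1) * (F' ?w - v) \<le> (\<Sum>t\<in>{0..n}. F' (x t) - v)"
    by (simp add: sum_subtractf field_simps)
  moreover have nonneg: "0 \<le> F' a - v" if "a \<in> C" for a
    using low[of a] F'[OF that] by simp
  ultimately have "ennreal ((real n + 1) * (F' ?w - v)) \<le> (\<Sum>t\<in>{0..n}. ennreal (F' (x t) - v))"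
    using xt by (subst sum_ennreal) (auto intro: ennreal_leI)
  also have "\<dots> = (\<Sum>t<Suc n. e2ennreal (H (x t) - ereal v))"
    using F'[OF xt] by (intro sum.cong) auto
  finally show ?thesis
    using nonneg[OF wC] F'[OF wC] by (simp add: ennreal_mult)
qed

section \<open>Iterations driven by independent samples\<close>

text \<open>The state \<open>x t\<close> is a measurable function of the samples before time \<open>t\<close> and hence independent
  of \<open>\<xi> t\<close>. The joint law of the past samples and the current one is thus a product, and Tonelli's theorem
  applies.\<close>

lemma markov_chain_step:
  fixes x :: "nat \<Rightarrow> 's \<Rightarrow> 'a" and \<xi> :: "nat \<Rightarrow> 's \<Rightarrow> 'w"
  assumes "prob_space M" and "prob_space P"
    and ind: "prob_space.indep_vars M (\<lambda>_. P) \<xi> UNIV" and distr: "\<And>t. distr M P (\<xi> t) = P"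
    and s: "\<And>t. s t \<in> N \<Otimes>\<^sub>M P \<rightarrow>\<^sub>M N"
    and x0: "x0 \<in> space N" "\<And>\<omega>. \<omega> \<in> space M \<Longrightarrow> x 0 \<omega> = x0"
    and step: "\<And>t \<omega>. \<omega> \<in> space M \<Longrightarrow> x (Suc t) \<omega> = s t (x t \<omega>, \<xi> t \<omega>)"
  shows "x t \<in> M \<rightarrow>\<^sub>M N" and
    "\<phi> \<in> borel_measurable N \<Longrightarrow>
      (\<integral>\<^sup>+\<omega>. \<phi> (x (Suc t) \<omega>) \<partial>M) = (\<integral>\<^sup>+\<omega>. (\<integral>\<^sup>+z. \<phi> (s t (x t \<omega>, z)) \<partial>P) \<partial>M)"
proof -
  interpret M: prob_space M by fact
  interpret P: prob_space P by fact
  let ?past = "\<lambda>t \<omega>. restrict (\<lambda>i. \<xi> i \<omega>) {..<t}"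
  have factor: "\<exists>g \<in> PiM {..<t} (\<lambda>_. P) \<rightarrow>\<^sub>M N. \<forall>\<omega>\<in>space M. x t \<omega> = g (?past t \<omega>)" for t
  proof (induction t)
    case 0
    show ?case
      by (rule bexI[of _ "\<lambda>_. x0"]) (use x0 in auto)
  next
    case (Suc t)
    then obtain g where g: "g \<in> PiM {..<t} (\<lambda>_. P) \<rightarrow>\<^sub>M N" "\<And>\<omega>. \<omega> \<in> space M \<Longrightarrow> x t \<omega> = g (?past t \<omega>)"
      by blast
    show ?case
    proof (intro bexI[of _ "\<lambda>w. s t (g (restrict w {..<t}), w t)"] ballI)
      fix \<omega> assume "\<omega> \<in> space M"
      moreover have "{..<Suc t} \<inter> {..<t} = {..<t}"
        by auto
      ultimately show "x (Suc t) \<omega> = s t (g (restrict (?past (Suc t) \<omega>) {..<t}), ?past (Suc t) \<omega> t)"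
        by (simp add: step g(2) restrict_restrict)
    next
      have "(\<lambda>w. (g (restrict w {..<t}), w t)) \<in> PiM {..<Suc t} (\<lambda>_. P) \<rightarrow>\<^sub>M N \<Otimes>\<^sub>M P"
        by (intro measurable_Pair measurable_compose[OF measurable_restrict_subset g(1)]
            measurable_component_singleton) auto
      then show "(\<lambda>w. s t (g (restrict w {..<t}), w t)) \<in> PiM {..<Suc t} (\<lambda>_. P) \<rightarrow>\<^sub>M N"
        by (rule measurable_compose[OF _ s])
    qed
  qed
  then obtain g where g: "g \<in> PiM {..<t} (\<lambda>_. P) \<rightarrow>\<^sub>M N" "\<And>\<omega>. \<omega> \<in> space M \<Longrightarrow> x t \<omega> = g (?past t \<omega>)"
    by blast
  \<comment> \<open>The current sample is treated as a family over \<open>{t}\<close>, so that past and present take values in the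
      same type of functions, as \<open>indep_var\<close> demands.\<close>
  let ?now = "\<lambda>\<omega>. restrict (\<lambda>i. \<xi> i \<omega>) {t}"
  let ?A = "PiM {..<t} (\<lambda>_. P)" and ?B = "PiM {t} (\<lambda>_. P)"
  have "M.indep_var ?A (?past t) ?B ?now"
    by (rule M.indep_var_restrict[OF ind]) auto
  then have rv: "?past t \<in> M \<rightarrow>\<^sub>M ?A" "?now \<in> M \<rightarrow>\<^sub>M ?B"
    and prod: "distr M ?A (?past t) \<Otimes>\<^sub>M distr M ?B ?now = distr M (?A \<Otimes>\<^sub>M ?B) (\<lambda>\<omega>. (?past t \<omega>, ?now \<omega>))"
    unfolding M.indep_var_distribution_eq by auto
  have g_past: "(\<lambda>\<omega>. g (?past t \<omega>)) \<in> M \<rightarrow>\<^sub>M N"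
    by (rule measurable_compose[OF rv(1) g(1)])
  show xm: "x t \<in> M \<rightarrow>\<^sub>M N"
    using g_past by (rule measurable_cong[THEN iffD1, rotated]) (simp add: g(2))
  assume \<phi>: "\<phi> \<in> borel_measurable N"
  have \<phi>s: "(\<lambda>z. \<phi> (s t z)) \<in> borel_measurable (N \<Otimes>\<^sub>M P)"
    by (rule measurable_compose[OF s \<phi>])
  have eval: "(\<lambda>w. w t) \<in> ?B \<rightarrow>\<^sub>M P"
    by (rule measurable_component_singleton) simp
  define \<psi> where "\<psi> = (\<lambda>(a, b). \<phi> (s t (g a, b t)))"
  have \<psi>: "\<psi> \<in> borel_measurable (?A \<Otimes>\<^sub>M ?B)"
    unfolding \<psi>_def case_prod_beta
    by (intro measurable_compose[OF _ \<phi>s] measurable_Pair measurable_compose[OF measurable_fst g(1)]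
        measurable_compose[OF measurable_snd eval])
  interpret now: prob_space "distr M ?B ?now"
    by (rule M.prob_space_distr[OF rv(2)])
  have "(\<integral>\<^sup>+\<omega>. \<phi> (x (Suc t) \<omega>) \<partial>M) = (\<integral>\<^sup>+\<omega>. \<psi> (?past t \<omega>, ?now \<omega>) \<partial>M)"
    by (rule nn_integral_cong) (simp add: step g(2) \<psi>_def)
  also have "\<dots> = (\<integral>\<^sup>+z. \<psi> z \<partial>distr M (?A \<Otimes>\<^sub>M ?B) (\<lambda>\<omega>. (?past t \<omega>, ?now \<omega>)))"
    by (rule nn_integral_distr[symmetric]) (use measurable_Pair[OF rv] \<psi> in simp_all)
  also have "\<dots> = (\<integral>\<^sup>+a. \<integral>\<^sup>+b. \<psi> (a, b) \<partial>distr M ?B ?now \<partial>distr M ?A (?past t))"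
    unfolding prod[symmetric]
    by (rule now.nn_integral_fst[symmetric]) (use \<psi> in \<open>simp cong: measurable_cong_sets\<close>)
  also have "\<dots> = (\<integral>\<^sup>+\<omega>. \<integral>\<^sup>+b. \<psi> (?past t \<omega>, b) \<partial>distr M ?B ?now \<partial>M)"
  proof (rule nn_integral_distr[OF rv(1)])
    have "\<psi> \<in> borel_measurable (?A \<Otimes>\<^sub>M distr M ?B ?now)"
      using \<psi> by (simp cong: measurable_cong_sets)
    then show "(\<lambda>a. \<integral>\<^sup>+b. \<psi> (a, b) \<partial>distr M ?B ?now) \<in> borel_measurable (distr M ?A (?past t))"
      using now.borel_measurable_nn_integral_fst by simp
  qed
  also have "\<dots> = (\<integral>\<^sup>+\<omega>. (\<integral>\<^sup>+z. \<phi> (s t (x t \<omega>, z)) \<partial>P) \<partial>M)"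
  proof (rule nn_integral_cong)
    fix \<omega> assume \<omega>: "\<omega> \<in> space M"
    have xN: "x t \<omega> \<in> space N"
      by (rule measurable_space[OF xm \<omega>])
    have \<phi>x: "(\<lambda>z. \<phi> (s t (x t \<omega>, z))) \<in> borel_measurable P"
      by (rule measurable_compose[OF measurable_Pair1'[OF xN] \<phi>s])
    have \<xi>: "\<xi> t \<in> M \<rightarrow>\<^sub>M P"
      using measurable_compose[OF rv(2) eval] by simp
    have "(\<integral>\<^sup>+b. \<psi> (?past t \<omega>, b) \<partial>distr M ?B ?now) = (\<integral>\<^sup>+b. \<phi> (s t (x t \<omega>, b t)) \<partial>distr M ?B ?now)"
      by (simp add: \<psi>_def g(2)[OF \<omega>])
    also have "\<dots> = (\<integral>\<^sup>+\<omega>'. \<phi> (s t (x t \<omega>, \<xi> t \<omega>')) \<partial>M)"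
      by (subst nn_integral_distr) (use rv(2) measurable_compose[OF eval \<phi>x] in simp_all)
    also have "\<dots> = (\<integral>\<^sup>+z. \<phi> (s t (x t \<omega>, z)) \<partial>distr M P (\<xi> t))"
      by (rule nn_integral_distr[symmetric]) (use \<xi> \<phi>x in simp_all)
    finally show "(\<integral>\<^sup>+b. \<psi> (?past t \<omega>, b) \<partial>distr M ?B ?now) = (\<integral>\<^sup>+z. \<phi> (s t (x t \<omega>, z)) \<partial>P)"
      unfolding distr .
  qed
  finally show "(\<integral>\<^sup>+\<omega>. \<phi> (x (Suc t) \<omega>) \<partial>M) = (\<integral>\<^sup>+\<omega>. (\<integral>\<^sup>+z. \<phi> (s t (x t \<omega>, z)) \<partial>P) \<partial>M)" .
qed

text \<open>A one-step decrease of the potentials \<open>V t\<close> that holds at every state, not just along the iterates,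
  can be integrated over the law of \<open>x t\<close> and summed.\<close>

lemma expected_gap_telescope:
  fixes x :: "nat \<Rightarrow> 's \<Rightarrow> 'a"
  assumes "prob_space M" and "prob_space P"
    and ind: "prob_space.indep_vars M (\<lambda>_. P) \<xi> UNIV" and distr: "\<And>t. distr M P (\<xi> t) = P"
    and s: "\<And>t. s t \<in> N \<Otimes>\<^sub>M P \<rightarrow>\<^sub>M N"
    and x0: "x0 \<in> space N" "\<And>\<omega>. \<omega> \<in> space M \<Longrightarrow> x 0 \<omega> = x0"
    and step: "\<And>t \<omega>. \<omega> \<in> space M \<Longrightarrow> x (Suc t) \<omega> = s t (x t \<omega>, \<xi> t \<omega>)"
    and V: "\<And>t. V t \<in> borel_measurable N" and G: "G \<in> borel_measurable N"
    and descent: "\<And>t a. a \<in> space N \<Longrightarrow> (\<integral>\<^sup>+z. V (Suc t) (s t (a, z)) \<partial>P) + G a \<le> V t a + c t"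
  shows "(\<integral>\<^sup>+\<omega>. (\<Sum>t<n. G (x t \<omega>)) + V n (x n \<omega>) \<partial>M) \<le> V 0 x0 + (\<Sum>t<n. c t :: ennreal)"
proof -
  interpret M: prob_space M by fact
  interpret P: prob_space P by fact
  have chain: "x t \<in> M \<rightarrow>\<^sub>M N"
    and chain_step: "\<phi> \<in> borel_measurable N \<Longrightarrow>
      (\<integral>\<^sup>+\<omega>. \<phi> (x (Suc t) \<omega>) \<partial>M) = (\<integral>\<^sup>+\<omega>. (\<integral>\<^sup>+z. \<phi> (s t (x t \<omega>, z)) \<partial>P) \<partial>M)" for t \<phi>
    using markov_chain_step[OF assms(1-5) x0 step] by blast+
  have Gx: "(\<lambda>\<omega>. G (x t \<omega>)) \<in> borel_measurable M" and Vx: "(\<lambda>\<omega>. V t (x t \<omega>)) \<in> borel_measurable M" for t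
    using measurable_compose[OF chain] G V by blast+
  have one_step: "(\<integral>\<^sup>+\<omega>. V (Suc t) (x (Suc t) \<omega>) \<partial>M) + (\<integral>\<^sup>+\<omega>. G (x t \<omega>) \<partial>M)
      \<le> (\<integral>\<^sup>+\<omega>. V t (x t \<omega>) \<partial>M) + c t" for t
  proof -
    have inner: "(\<lambda>\<omega>. \<integral>\<^sup>+z. V (Suc t) (s t (x t \<omega>, z)) \<partial>P) \<in> borel_measurable M"
      by (rule measurable_compose[OF chain
            P.borel_measurable_nn_integral_fst[OF measurable_compose[OF s V]]])
    have "(\<integral>\<^sup>+\<omega>. V (Suc t) (x (Suc t) \<omega>) \<partial>M) + (\<integral>\<^sup>+\<omega>. G (x t \<omega>) \<partial>M)
        = (\<integral>\<^sup>+\<omega>. (\<integral>\<^sup>+z. V (Suc t) (s t (x t \<omega>, z)) \<partial>P) + G (x t \<omega>) \<partial>M)"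
      unfolding chain_step[OF V] by (rule nn_integral_add[OF inner Gx, symmetric])
    also have "\<dots> \<le> (\<integral>\<^sup>+\<omega>. V t (x t \<omega>) + c t \<partial>M)"
      by (intro nn_integral_mono descent measurable_space[OF chain])
    also have "\<dots> = (\<integral>\<^sup>+\<omega>. V t (x t \<omega>) \<partial>M) + c t"
      by (subst nn_integral_add[OF Vx]) (auto simp: M.emeasure_space_1)
    finally show ?thesis .
  qed
  have "(\<Sum>t<n. \<integral>\<^sup>+\<omega>. G (x t \<omega>) \<partial>M) + (\<integral>\<^sup>+\<omega>. V n (x n \<omega>) \<partial>M) \<le> V 0 x0 + (\<Sum>t<n. c t)"
  proof (induction n)
    case 0
    have "(\<integral>\<^sup>+\<omega>. V 0 (x 0 \<omega>) \<partial>M) = (\<integral>\<^sup>+\<omega>. V 0 x0 \<partial>M)"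
      by (rule nn_integral_cong) (simp add: x0)
    then show ?case
      by (simp add: M.emeasure_space_1)
  next
    case (Suc n)
    have "(\<Sum>t<Suc n. \<integral>\<^sup>+\<omega>. G (x t \<omega>) \<partial>M) + (\<integral>\<^sup>+\<omega>. V (Suc n) (x (Suc n) \<omega>) \<partial>M)
        = (\<Sum>t<n. \<integral>\<^sup>+\<omega>. G (x t \<omega>) \<partial>M)
          + ((\<integral>\<^sup>+\<omega>. V (Suc n) (x (Suc n) \<omega>) \<partial>M) + (\<integral>\<^sup>+\<omega>. G (x n \<omega>) \<partial>M))"
      by (simp add: ac_simps)
    also have "\<dots> \<le> (\<Sum>t<n. \<integral>\<^sup>+\<omega>. G (x t \<omega>) \<partial>M) + ((\<integral>\<^sup>+\<omega>. V n (x n \<omega>) \<partial>M) + c n)"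
      by (rule add_left_mono[OF one_step])
    also have "\<dots> \<le> (V 0 x0 + (\<Sum>t<n. c t)) + c n"
      unfolding add.assoc[symmetric] by (rule add_right_mono[OF Suc.IH])
    finally show ?case
      by (simp add: add.assoc)
  qed
  then show ?thesis
    by (subst nn_integral_add[OF borel_measurable_sum[OF Gx] Vx]) (simp add: nn_integral_sum[OF Gx])
qed

lemma sum_inverse_le_ln: "(\<Sum>t<Suc n. 1 / (real t + 1)) \<le> 1 + ln (real n + 1)"
proof -
  have "harm (Suc n) - ln (real (Suc n)) \<le> (harm (Suc 0) - ln (real (Suc 0)) :: real)"
    by (rule decseqD[OF decseq_harm_diff_ln]) simp
  moreover have "harm (Suc n) = (\<Sum>t<Suc n. 1 / (real t + 1))"
    unfolding harm_altdef by (intro sum.cong) (auto simp: field_simps)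
  moreover have "harm (Suc 0) = (1::real)"
    by (simp add: harm_expand)
  ultimately show ?thesis
    by (simp add: add.commute)
qed

section \<open>Convergence of the averaged iterates\<close>

theorem theorem7p4:
  fixes \<Phi> :: "'a::euclidean_space \<Rightarrow> ereal" and f :: "'a \<Rightarrow> real" and r :: "'a \<Rightarrow> ereal"
    and P :: "'w measure" and m :: "'a \<Rightarrow> 'a \<Rightarrow> 'w \<Rightarrow> real"
    and L :: "'w \<Rightarrow> real" and Lbar \<mu> :: real
    and S :: "real \<Rightarrow> 'a \<times> 'w \<Rightarrow> 'a"
    and M :: "'s measure" and \<xi> :: "nat \<Rightarrow> 's \<Rightarrow> 'w" and x :: "nat \<Rightarrow> 's \<Rightarrow> 'a"
    and \<eta> :: "nat \<Rightarrow> real" and x0 xstar :: 'a and T :: nat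
  defines "F \<equiv> (\<lambda>y. ereal (f y) + r y)"
  assumes "legendre \<Phi>" and "composite_problem \<Phi> f r"
    and "prob_space P" and "prob_space M"
    and "prob_space.indep_vars M (\<lambda>_. P) \<xi> UNIV" and "\<And>t. distr M P (\<xi> t) = P"
    and "unbiased_lower_model \<Phi> f r P m"
    and "\<mu> > 0" and "rel_strongly_convex_model \<Phi> r P m \<mu>"
    and "rel_lipschitz_model \<Phi> r P m L Lbar"
    and "solvable_subproblems \<Phi> f r P m S"
    and "x0 \<in> interior (edom \<Phi>) \<inter> edom r"
    and "\<And>\<omega>. \<omega> \<in> space M \<Longrightarrow> x 0 \<omega> = x0"
    and "\<And>t \<omega>. \<omega> \<in> space M \<Longrightarrow> x (Suc t) \<omega> = S (\<eta> t) (x t \<omega>, \<xi> t \<omega>)"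
    and "\<And>t. \<eta> t = 1 / (\<mu> * (real t + 1))"
    and "is_arg_min F (\<lambda>_. True) xstar"
    and "T > 0"
  shows "ereal_expectation M (\<lambda>\<omega>.
           F ((1 / (real T + 1)) *\<^sub>R (\<Sum>t=0..T. x t \<omega>)) - F xstar
             + ereal \<mu> * bregman \<Phi> xstar (x (Suc T) \<omega>))
         \<le> (ereal (Lbar\<^sup>2 * (1 + ln (real T + 1)) / (4 * \<mu>)) + r x0 - (INF y. r y)
             + ereal \<mu> * bregman \<Phi> xstar x0) / ereal (real T + 1)"
proof -
  let ?U = "interior (edom \<Phi>)" and ?r = "\<lambda>y. real_of_ereal (r y)" and ?D = "real_bregman \<Phi>"
  note leg = assms(2) and prob = assms(3) and unb = assms(8) and mu = assms(9) and conv = assms(10)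
    and lip = assms(11) and solv = assms(12) and x0 = assms(13) and init = assms(14) and step = assms(15)
    and eta = assms(16)
  have rninf: "\<And>z. r z \<noteq> -\<infinity>" and rcl: "closed_fun r" and rconv: "convex (edom r)"
    and fcont: "isCont f z" for z
  proof -
    show "\<And>z. r z \<noteq> -\<infinity>" "closed_fun r" "convex (edom r)"
      using prob by (auto simp: composite_problem_def)
    obtain e K where "e > 0" "K-lipschitz_on (ball z e) f"
      using prob unfolding composite_problem_def locally_lipschitz_def by metis
    then have "continuous_on (ball z e) f"
      by (intro lipschitz_on_continuous_on)
    then show "isCont f z"
      using \<open>e > 0\<close> by (simp add: continuous_on_eq_continuous_at)
  qed
  have phininf: "\<And>z. \<Phi> z \<noteq> -\<infinity>" and phicl: "closed_fun \<Phi>"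
    using leg by (auto simp: legendre_def)
  have rfin: "r z = ereal (?r z)" if "z \<in> edom r" for z
    using rninf that by (rule ereal_real_edom)
  have x0U: "x0 \<in> ?U" and x0r: "x0 \<in> edom r"
    using x0 by auto
  have Fmin: "F xstar \<le> F z" for z
    using assms(17) by (auto simp: is_arg_min_def not_less)
  have xstar_r: "xstar \<in> edom r"
  proof -
    have "F x0 = ereal (f x0 + ?r x0)"
      unfolding F_def by (subst rfin[OF x0r]) simp
    then have "F xstar \<noteq> \<infinity>"
      using Fmin[of x0] by auto
    then show ?thesis
      by (auto simp: F_def edom_def)
  qed
  define v where "v = f xstar + ?r xstar"
  have Fstar: "F xstar = ereal v"
    unfolding F_def v_def by (subst rfin[OF xstar_r]) simp
  have Flow: "ereal v \<le> ereal (f z) + r z" for z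
    using Fmin[of z] unfolding Fstar by (simp add: F_def)
  have inf_le: "(INF y. r y) \<le> ereal (?r x0)"
    unfolding rfin[OF x0r, symmetric] by (rule INF_lower) simp
  show ?thesis
  proof (cases "xstar \<in> edom \<Phi> \<and> (INF y. r y) \<noteq> -\<infinity>")
    case False
    \<comment> \<open>The right-hand side is then infinite.\<close>
    have "x0 \<in> edom \<Phi>"
      using x0U interior_subset by blast
    then obtain p where p: "\<Phi> x0 = ereal p"
      using phininf[of x0] by (cases "\<Phi> x0") (auto simp: edom_def)
    have breg: "bregman \<Phi> xstar x0 \<noteq> -\<infinity>" "xstar \<notin> edom \<Phi> \<Longrightarrow> bregman \<Phi> xstar x0 = \<infinity>"
      using phininf[of xstar] unfolding bregman_def p by (cases "\<Phi> xstar"; simp add: edom_def)+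
    obtain q where q: "r x0 = ereal q"
      using rfin[OF x0r] by blast
    have "(ereal (Lbar\<^sup>2 * (1 + ln (real T + 1)) / (4 * \<mu>)) + r x0 - (INF y. r y)
             + ereal \<mu> * bregman \<Phi> xstar x0) / ereal (real T + 1) = \<infinity>"
      using False breg inf_le mu unfolding q
      by (cases "INF y. r y"; cases "bregman \<Phi> xstar x0") auto
    then show ?thesis
      by (simp only: ereal_less_eq(1))
  next
    case True
    then obtain \<rho> where \<rho>: "(INF y. r y) = ereal \<rho>"
      using inf_le by (cases "INF y. r y") auto
    have rlow: "ereal \<rho> \<le> r z" for z
      unfolding \<rho>[symmetric] by (rule INF_lower) simp
    obtain Y where Ysub: "\<And>n::nat. limiting_subdiff (\<lambda>y. r y + \<Phi> y) (Y n) \<noteq> {}"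
      and Yr: "\<And>n. Y n \<in> edom r" and Ylim: "Y \<longlonglongrightarrow> xstar"
      and Yrlim: "(\<lambda>n. ?r (Y n)) \<longlonglongrightarrow> ?r xstar"
      and Yphi: "(\<lambda>n. real_of_ereal (\<Phi> (Y n))) \<longlonglongrightarrow> real_of_ereal (\<Phi> xstar)"
      using dense_subdifferentiability[OF rcl phicl rninf phininf xstar_r conjunct1[OF True]] by metis
    have YU: "Y n \<in> ?U" for n
      using Ysub prob unfolding composite_problem_def by blast
    have Dlim: "(\<lambda>n. ?D (Y n) a) \<longlonglongrightarrow> ?D xstar a" if "a \<in> ?U" for a
    proof -
      have eq: "?D y a = real_of_ereal (\<Phi> y) - real_of_ereal (\<Phi> a) - egrad \<Phi> a \<bullet> (y - a)" if "y \<in> edom \<Phi>" for y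
        using bregman_eq_real[OF leg \<open>a \<in> ?U\<close> that] by simp
      have "Y n \<in> edom \<Phi>" for n
        using YU interior_subset by blast
      then show ?thesis
        using True by (simp only: eq) (intro tendsto_intros Yphi Ylim)
    qed
    define N where "N = restrict_space borel ?U"
    have spaceN: "space N = ?U"
      by (simp add: N_def)
    have s: "S (\<eta> t) \<in> N \<Otimes>\<^sub>M P \<rightarrow>\<^sub>M N" for t
      using solv mu unfolding N_def solvable_subproblems_def Let_def by (simp add: eta)
    have x0N: "x0 \<in> space N"
      using x0U by (simp add: spaceN)
    have xN: "x t \<in> M \<rightarrow>\<^sub>M N" for t
      by (rule markov_chain_step(1)[OF assms(5,4,6,7) s x0N init step])
    have xU: "x t \<omega> \<in> ?U" if "\<omega> \<in> space M" for t \<omega>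
      using measurable_space[OF xN that] by (simp add: spaceN)
    \<comment> \<open>The potential at time \<open>t\<close> weights the divergence from the comparison point \<open>y\<close> by
        \<open>1 / \<eta> t = \<mu> (t + 1)\<close>.\<close>
    define G where "G a = e2ennreal (F a - ereal v)" for a
    define V where "V y t a = e2ennreal (r a - ereal \<rho>) + ennreal (\<mu> * (real t + 1) * ?D y a)" for y t a
    define c where "c y t = ennreal (f y + ?r y - v + Lbar\<^sup>2 / (4 * (\<mu> * (real t + 1))))" for y and t :: nat
    have rN: "r \<in> borel_measurable N"
      unfolding N_def by (rule measurable_restrict_space1[OF borel_measurable_closed_fun[OF rcl]])
    have fN: "f \<in> borel_measurable N"
      unfolding N_def using fcont
      by (intro measurable_restrict_space1 borel_measurable_continuous_onI continuous_at_imp_continuous_on) simp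
    have GN: "G \<in> borel_measurable N"
      unfolding G_def F_def using rN fN by measurable
    have DN: "?D (Y k) \<in> borel_measurable N" for k
      unfolding N_def by (rule borel_measurable_real_bregman[OF leg YU])
    have VN: "V (Y k) t \<in> borel_measurable N" for k t
      unfolding V_def using rN DN by measurable
    have descent: "(\<integral>\<^sup>+z. V (Y k) (Suc t) (S (\<eta> t) (a, z)) \<partial>P) + G a \<le> V (Y k) t a + c (Y k) t"
      if "a \<in> space N" for k t a
    proof -
      have \<alpha>: "1 / \<eta> t = \<mu> * (real t + 1)" "\<eta> t > 0" "\<mu> * (real t + 1) > 0"
        using mu by (simp_all add: eta)
      have "AE z in P. unique_minimizer_on ?U
          (\<lambda>y. ereal (m a y z) + r y + ereal (1 / \<eta> t) * bregman \<Phi> y a) (S (\<eta> t) (a, z))"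
        using solv \<alpha>(2) that unfolding solvable_subproblems_def Let_def spaceN by blast
      then have "AE z in P. is_arg_min
          (\<lambda>y. ereal (m a y z) + r y + ereal (\<mu> * (real t + 1)) * bregman \<Phi> y a)
          (\<lambda>y. y \<in> ?U) (S (\<eta> t) (a, z))"
        unfolding \<alpha>(1) unique_minimizer_on_def by eventually_elim blast
      from stochastic_step[OF leg rninf assms(4) mu \<alpha>(3) unb conv lip rlow Flow _ YU Yr this, of k]
      show ?thesis
        using that unfolding V_def G_def c_def F_def spaceN by (simp add: algebra_simps)
    qed
    define B where "B y = ?r x0 - \<rho> + \<mu> * ?D y x0 + (real T + 1) * (f y + ?r y - v)
        + Lbar\<^sup>2 / (4 * \<mu>) * (1 + ln (real T + 1))" for y
    \<comment> \<open>The final potential carries the weight \<open>\<mu> (T + 2)\<close>; the factor \<open>T + 1\<close> used here is the one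
        that division by \<open>T + 1\<close> cancels.\<close>
    define u where "u k \<omega> = (\<Sum>t<Suc T. G (x t \<omega>)) + ennreal ((real T + 1) * (\<mu> * ?D (Y k) (x (Suc T) \<omega>)))" for k \<omega>
    have Dpos: "0 \<le> ?D (Y k) a" if "a \<in> ?U" for k a
      using real_bregman_nonneg[OF leg that, of "Y k"] YU[of k] interior_subset[of "edom \<Phi>"] by blast
    have gap: "0 \<le> f (Y k) + ?r (Y k) - v" for k
      using Flow[of "Y k"] by (subst (asm) rfin[OF Yr]) simp
    have um: "u k \<in> borel_measurable M" for k
      unfolding u_def
      using measurable_compose[OF xN GN] measurable_compose[OF xN DN] by measurable
    have r0: "0 \<le> ?r x0 - \<rho>"
      using rlow[of x0] by (subst (asm) rfin[OF x0r]) simp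
    have u_bound: "(\<integral>\<^sup>+\<omega>. u k \<omega> \<partial>M) \<le> ennreal (B (Y k))" for k
    proof -
      have "(\<integral>\<^sup>+\<omega>. u k \<omega> \<partial>M) \<le> (\<integral>\<^sup>+\<omega>. (\<Sum>t<Suc T. G (x t \<omega>)) + V (Y k) (Suc T) (x (Suc T) \<omega>) \<partial>M)"
      proof (rule nn_integral_mono)
        fix \<omega> assume "\<omega> \<in> space M"
        then have "(real T + 1) * (\<mu> * ?D (Y k) (x (Suc T) \<omega>)) \<le> \<mu> * (real (Suc T) + 1) * ?D (Y k) (x (Suc T) \<omega>)"
          using Dpos[OF xU, of \<omega> k "Suc T"] mu by (simp add: algebra_simps)
        then show "u k \<omega> \<le> (\<Sum>t<Suc T. G (x t \<omega>)) + V (Y k) (Suc T) (x (Suc T) \<omega>)"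
          unfolding u_def V_def by (intro add_left_mono add_increasing ennreal_leI) auto
      qed
      also have "\<dots> \<le> V (Y k) 0 x0 + (\<Sum>t<Suc T. c (Y k) t)"
        by (rule expected_gap_telescope[OF assms(5,4,6,7) s x0N init step VN GN descent])
      also have "(\<Sum>t<Suc T. c (Y k) t) = ennreal (\<Sum>t<Suc T. f (Y k) + ?r (Y k) - v + Lbar\<^sup>2 / (4 * \<mu>) * (1 / (real t + 1)))"
        unfolding c_def using gap mu by (subst sum_ennreal) (auto simp: mult.assoc)
      also have "\<dots> \<le> ennreal ((real T + 1) * (f (Y k) + ?r (Y k) - v) + Lbar\<^sup>2 / (4 * \<mu>) * (1 + ln (real T + 1)))"
      proof (rule ennreal_leI)
        have "(\<Sum>t<Suc T. f (Y k) + ?r (Y k) - v + Lbar\<^sup>2 / (4 * \<mu>) * (1 / (real t + 1)))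
            = (real T + 1) * (f (Y k) + ?r (Y k) - v) + Lbar\<^sup>2 / (4 * \<mu>) * (\<Sum>t<Suc T. 1 / (real t + 1))"
          unfolding sum.distrib sum_distrib_left[symmetric] by (simp add: algebra_simps)
        also have "\<dots> \<le> (real T + 1) * (f (Y k) + ?r (Y k) - v) + Lbar\<^sup>2 / (4 * \<mu>) * (1 + ln (real T + 1))"
          using mu by (intro add_left_mono mult_left_mono sum_inverse_le_ln) auto
        finally show "(\<Sum>t<Suc T. f (Y k) + ?r (Y k) - v + Lbar\<^sup>2 / (4 * \<mu>) * (1 / (real t + 1)))
            \<le> (real T + 1) * (f (Y k) + ?r (Y k) - v) + Lbar\<^sup>2 / (4 * \<mu>) * (1 + ln (real T + 1))" .
      qed
      also have "V (Y k) 0 x0 = ennreal (?r x0 - \<rho> + \<mu> * ?D (Y k) x0)"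
      proof -
        have "0 \<le> \<mu> * ?D (Y k) x0"
          using mu Dpos[OF x0U] by simp
        moreover have "e2ennreal (r x0 - ereal \<rho>) = ennreal (?r x0 - \<rho>)"
          by (subst rfin[OF x0r]) simp
        ultimately show ?thesis
          using r0 unfolding V_def by (simp add: ennreal_plus)
      qed
      also have "ennreal (?r x0 - \<rho> + \<mu> * ?D (Y k) x0)
          + ennreal ((real T + 1) * (f (Y k) + ?r (Y k) - v) + Lbar\<^sup>2 / (4 * \<mu>) * (1 + ln (real T + 1)))
          = ennreal (B (Y k))"
      proof -
        have "0 \<le> \<mu> * ?D (Y k) x0"
          using mu Dpos[OF x0U] by simp
        moreover have "0 \<le> (real T + 1) * (f (Y k) + ?r (Y k) - v)"
          using gap by simp
        moreover have "0 \<le> Lbar\<^sup>2 / (4 * \<mu>) * (1 + ln (real T + 1))"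
          using mu by simp
        ultimately show ?thesis
          using r0 unfolding B_def by (subst ennreal_plus[symmetric]) (auto simp: algebra_simps)
      qed
      finally show ?thesis
        by (simp add: add_left_mono)
    qed
    define X where "X \<omega> = F ((1 / (real T + 1)) *\<^sub>R (\<Sum>t=0..T. x t \<omega>)) - F xstar
             + ereal \<mu> * bregman \<Phi> xstar (x (Suc T) \<omega>)" for \<omega>
    have Dstar: "bregman \<Phi> xstar a = ereal (?D xstar a)" "0 \<le> ?D xstar a" if "a \<in> ?U" for a
      using bregman_eq_real[OF leg that, of xstar] real_bregman_nonneg[OF leg that, of xstar] True by simp_all
    have X: "X \<omega> = (F ((1 / (real T + 1)) *\<^sub>R (\<Sum>t=0..T. x t \<omega>)) - ereal v) + ereal (\<mu> * ?D xstar (x (Suc T) \<omega>))"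
      if "\<omega> \<in> space M" for \<omega>
      unfolding X_def Fstar by (subst Dstar(1)[OF xU[OF that]]) simp
    have Fgap: "0 \<le> F z - ereal v" for z
      using Fmin[of z] unfolding Fstar by (simp add: ereal_diff_positive)
    have Xpos: "0 \<le> X \<omega>" if "\<omega> \<in> space M" for \<omega>
      unfolding X[OF that] using Fgap Dstar(2)[OF xU[OF that]] mu by simp
    have X_le: "e2ennreal (X \<omega>) \<le> liminf (\<lambda>k. ennreal (1 / (real T + 1)) * u k \<omega>)"
      if "\<omega> \<in> space M" for \<omega>
    proof -
      let ?z = "(1 / (real T + 1)) *\<^sub>R (\<Sum>t=0..T. x t \<omega>)"
      let ?d = "\<mu> * ?D xstar (x (Suc T) \<omega>)"
      have d: "0 \<le> ?d"
        using Dstar(2)[OF xU[OF that]] mu by simp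
      have "ennreal (real T + 1) * G ?z \<le> (\<Sum>t<Suc T. G (x t \<omega>))"
        unfolding G_def
      proof (rule gap_average_le[OF objective_convex[OF leg rninf rconv assms(4) mu unb conv]])
        show "x t \<omega> \<in> ?U" for t
          by (rule xU[OF that])
        show "?U \<inter> edom r = {a \<in> ?U. F a < \<infinity>}"
          by (auto simp: F_def edom_def)
        show "F a = ereal (f a + ?r a)" if "a \<in> ?U \<inter> edom r" for a
          unfolding F_def using that by (subst rfin) auto
        show "ereal v \<le> F a" for a
          unfolding F_def by (rule Flow)
      qed
      then have "ennreal (real T + 1) * G ?z + ennreal ((real T + 1) * ?d)
          \<le> (\<Sum>t<Suc T. G (x t \<omega>)) + ennreal ((real T + 1) * ?d)"
        by (rule add_right_mono)
      moreover have "e2ennreal (X \<omega>) = G ?z + ennreal ?d"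
        unfolding X[OF that] G_def using Fgap[of ?z] d
        by (cases "F ?z - ereal v") (auto simp: ennreal_plus)
      ultimately have "ennreal (real T + 1) * e2ennreal (X \<omega>)
          \<le> (\<Sum>t<Suc T. G (x t \<omega>)) + ennreal ((real T + 1) * ?d)"
        using d by (simp add: distrib_left ennreal_mult)
      then have "ennreal (1 / (real T + 1)) * (ennreal (real T + 1) * e2ennreal (X \<omega>))
          \<le> ennreal (1 / (real T + 1)) * ((\<Sum>t<Suc T. G (x t \<omega>)) + ennreal ((real T + 1) * ?d))"
        by (rule mult_left_mono) simp
      moreover have "ennreal (1 / (real T + 1)) * ennreal (real T + 1) = 1"
        by (subst ennreal_mult[symmetric]) auto
      ultimately have "e2ennreal (X \<omega>)
          \<le> ennreal (1 / (real T + 1)) * ((\<Sum>t<Suc T. G (x t \<omega>)) + ennreal ((real T + 1) * ?d))"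
        by (simp only: mult.assoc[symmetric] mult_1)
      moreover have "(\<lambda>k. ennreal (1 / (real T + 1)) * u k \<omega>)
          \<longlonglongrightarrow> ennreal (1 / (real T + 1)) * ((\<Sum>t<Suc T. G (x t \<omega>)) + ennreal ((real T + 1) * ?d))"
        unfolding u_def
        by (intro ennreal_tendsto_cmult tendsto_add tendsto_const tendsto_ennrealI tendsto_mult_left
            Dlim xU that) auto
      ultimately show ?thesis
        by (simp add: lim_imp_Liminf)
    qed
    \<comment> \<open>Fatou's lemma, as the comparison points \<open>Y k\<close> tend to \<open>xstar\<close>.\<close>
    have "(\<integral>\<^sup>+\<omega>. e2ennreal (X \<omega>) \<partial>M) \<le> (\<integral>\<^sup>+\<omega>. liminf (\<lambda>k. ennreal (1 / (real T + 1)) * u k \<omega>) \<partial>M)"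
      by (rule nn_integral_mono[OF X_le])
    also have "\<dots> \<le> liminf (\<lambda>k. \<integral>\<^sup>+\<omega>. ennreal (1 / (real T + 1)) * u k \<omega> \<partial>M)"
      by (rule nn_integral_liminf) (use um in measurable)
    also have "\<dots> \<le> liminf (\<lambda>k. ennreal (B (Y k) / (real T + 1)))"
    proof (rule Liminf_mono, rule always_eventually, rule allI)
      fix k
      have "(\<integral>\<^sup>+\<omega>. ennreal (1 / (real T + 1)) * u k \<omega> \<partial>M) \<le> ennreal (1 / (real T + 1)) * ennreal (B (Y k))"
        unfolding nn_integral_cmult[OF um] by (rule mult_left_mono[OF u_bound]) simp
      then show "(\<integral>\<^sup>+\<omega>. ennreal (1 / (real T + 1)) * u k \<omega> \<partial>M) \<le> ennreal (B (Y k) / (real T + 1))"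
        by (simp add: ennreal_mult'[symmetric])
    qed
    also have "\<dots> = ennreal (B xstar / (real T + 1))"
    proof (rule lim_imp_Liminf)
      have "(\<lambda>k. f (Y k)) \<longlonglongrightarrow> f xstar"
        by (rule isCont_tendsto_compose[OF fcont Ylim])
      then show "(\<lambda>k. ennreal (B (Y k) / (real T + 1))) \<longlonglongrightarrow> ennreal (B xstar / (real T + 1))"
        unfolding B_def by (intro tendsto_ennrealI tendsto_intros Yrlim Dlim[OF x0U]) auto
    qed simp
    finally have EX: "(\<integral>\<^sup>+\<omega>. e2ennreal (X \<omega>) \<partial>M) \<le> ennreal (B xstar / (real T + 1))" .
    have Bpos: "0 \<le> B xstar"
      using r0 unfolding B_def v_def using mu Dstar(2)[OF x0U] by simp
    have "(\<integral>\<^sup>+\<omega>. e2ennreal (- X \<omega>) \<partial>M) = (\<integral>\<^sup>+\<omega>. 0 \<partial>M)"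
      by (rule nn_integral_cong) (use Xpos in \<open>simp add: e2ennreal_neg\<close>)
    then have "ereal_expectation M X = enn2ereal (\<integral>\<^sup>+\<omega>. e2ennreal (X \<omega>) \<partial>M)"
      by (simp add: ereal_expectation_def zero_ennreal.rep_eq)
    also have "\<dots> \<le> enn2ereal (ennreal (B xstar / (real T + 1)))"
      using EX by (simp add: less_eq_ennreal.rep_eq)
    also have "\<dots> = ereal (B xstar) / ereal (real T + 1)"
      using Bpos by (simp add: enn2ereal_ennreal)
    also have "ereal (B xstar) = ereal (Lbar\<^sup>2 * (1 + ln (real T + 1)) / (4 * \<mu>)) + r x0 - (INF y. r y)
             + ereal \<mu> * bregman \<Phi> xstar x0"
      unfolding \<rho> by (subst rfin[OF x0r], subst Dstar(1)[OF x0U]) (simp add: B_def v_def)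
    finally show ?thesis
      unfolding X_def .
  qed
qed

end
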